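(* Let $p$ be an odd prime, $q=p^r$ with $r\geq1$, and $n=2t$ with $t\geq5$. The number of equivalence classes of the codes $\mathcal{C}_{h,t,\sigma}\subseteq\mathcal{L}_{n,q}$, where $\sigma$ ranges over all generators of $\mathrm{Gal}(\mathbb{F}_{q^n}/\mathbb{F}_q)$ and $h$ ranges over all elements of $\mathbb{F}_{q^n}$ with $\mathrm{N}_{q^n/q^t}(h)=-1$, is at least $$\begin{cases}\left\lfloor\dfrac{\varphi(t)(q^t+1)}{4rt(q^2+1)}\right\rfloor&\text{if }t\equiv2\pmod4,\\[2ex]\left\lfloor\dfrac{\varphi(t)(q^t+1)}{8rt}\right\rfloor&\text{if }t\not\equiv2\pmod4,\end{cases}$$ where $\varphi$ is Euler's totient function.
   Context: $\mathrm{N}_{q^n/q^t}(h)=h^{q^t+1}=h\,\sigma^t(h)$ is the norm from $\mathbb{F}_{q^n}$ to $\mathbb{F}_{q^t}$. For a generator $\sigma$ of $\mathrm{Gal}(\mathbb{F}_{q^n}/\mathbb{F}_q)$, $\mathcal{L}_{n,q}$ denotes the ring (under addition and composition) of $\sigma$-polynomials $f(x)=\sum_{i=0}^{n-1}f_ix^{\sigma^i}$, $f_i\in\mathbb{F}_{q^n}$, each identified with the $\mathbb{F}_q$-endomorphism $\alpha\mapsto\sum_i f_i\sigma^i(\alpha)$ of $\mathbb{F}_{q^n}$; thus $\mathcal{L}_{n,q}\cong\mathrm{End}_{\mathbb{F}_q}(\mathbb{F}_{q^n})$, independently of $\sigma$. $\langle\cdot\rangle_{\mathbb{F}_{q^n}}$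 denotes the span with respect to left multiplication by scalars of $\mathbb{F}_{q^n}$. A rank-metric code is a subset of $\mathcal{L}_{n,q}$. Two rank-metric codes $\mathcal{C}_1,\mathcal{C}_2\subseteq\mathcal{L}_{n,q}$ are equivalent if there exist invertible $f_1,f_2\in\mathcal{L}_{n,q}$ and a field automorphism $\rho\in\mathrm{Aut}(\mathbb{F}_{q^n})$ with $\mathcal{C}_1=\{f_1\circ g^{\rho}\circ f_2: g\in\mathcal{C}_2\}$, where $g^{\rho}(x)=\sum_i\rho(a_i)x^{\sigma^i}$ if $g(x)=\sum_i a_ix^{\sigma^i}$. $\mathcal{C}_{h,t,\sigma}=\langle x,\psi_{h,t,\sigma}(x)\rangle_{\mathbb{F}_{q^n}}$, where $\psi_{h,t,\sigma}(x)=x^{\sigma}+x^{\sigma^{t-1}}+h\sigma(h)x^{\sigma^{t+1}}+h\sigma^{-1}(h^{-1})x^{\sigma^{2t-1}}$. *)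

theory Defs
  imports Complex_Main "HOL-Number_Theory.Totient"
begin

text \<open>
  The field with \<open>q^n\<close> elements is a type \<open>'a\<close> of class field and finite with \<open>card UNIV = q^n\<close>;
  its subfield with \<open>q\<close> elements is \<open>{x. x ^ q = x}\<close>.
\<close>

definition field_aut :: "('a::field \<Rightarrow> 'a) \<Rightarrow> bool" where
  "field_aut \<rho> \<longleftrightarrow> bij \<rho> \<and> \<rho> 1 = 1 \<and>
     (\<forall>x y. \<rho> (x + y) = \<rho> x + \<rho> y) \<and> (\<forall>x y. \<rho> (x * y) = \<rho> x * \<rho> y)"

definition Gal :: "nat \<Rightarrow> ('a::field \<Rightarrow> 'a) set" where
  "Gal q = {\<tau>. field_aut \<tau> \<and> (\<forall>x. x ^ q = x \<longrightarrow> \<tau> x = x)}"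

text \<open>Nonnegative powers suffice for generation, since the Galois group is finite.\<close>

definition Gal_generator :: "nat \<Rightarrow> ('a::field \<Rightarrow> 'a) \<Rightarrow> bool" where
  "Gal_generator q \<sigma> \<longleftrightarrow> \<sigma> \<in> Gal q \<and> (\<forall>\<tau>\<in>Gal q. \<exists>k::nat. \<tau> = \<sigma> ^^ k)"

text \<open>
  \<open>\<sigma>\<close>-polynomials, as maps: the coefficients are \<open>a 0, ..., a (n - 1)\<close>, the other values of \<open>a\<close>
  are ignored, and \<open>x\<close> to the power \<open>\<sigma>^i\<close> is the \<open>i\<close>-fold iterate of \<open>\<sigma>\<close> at \<open>x\<close>.
\<close>

definition sigma_poly :: "('a::field \<Rightarrow> 'a) \<Rightarrow> nat \<Rightarrow> (nat \<Rightarrow> 'a) \<Rightarrow> 'a \<Rightarrow> 'a" where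
  "sigma_poly \<sigma> n a = (\<lambda>x. \<Sum>i<n. a i * (\<sigma> ^^ i) x)"

definition frob :: "nat \<Rightarrow> 'a::field \<Rightarrow> 'a" where
  "frob q x = x ^ q"

text \<open>
  The ring of \<open>\<sigma>\<close>-polynomials does not depend on the generator \<open>\<sigma>\<close> of the Galois group, so it
  is defined with the Frobenius map.
\<close>

definition Lpoly :: "nat \<Rightarrow> nat \<Rightarrow> ('a::field \<Rightarrow> 'a) set" where
  "Lpoly n q = range (sigma_poly (frob q) n)"

definition Lpoly_invertible :: "nat \<Rightarrow> nat \<Rightarrow> ('a::field \<Rightarrow> 'a) \<Rightarrow> bool" where
  "Lpoly_invertible n q f \<longleftrightarrow> f \<in> Lpoly n q \<and> (\<exists>g\<in>Lpoly n q. f \<circ> g = id \<and> g \<circ> f = id)"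

text \<open>
  Here \<open>g\<close> ranges over \<open>C2\<close> through its coefficients \<open>a\<close>, and \<open>\<rho> \<circ> a\<close> are the coefficients
  of \<open>g\<close> twisted by \<open>\<rho>\<close>. The twist depends neither on the choice of \<open>a\<close>
  (see \<open>sigma_poly_twist\<close>) nor on the generator with respect to which coefficients are taken,
  because \<open>\<sigma>\<close> and \<open>\<rho>\<close> commute.
\<close>

definition code_equiv ::
    "nat \<Rightarrow> nat \<Rightarrow> ('a::field \<Rightarrow> 'a) set \<Rightarrow> ('a \<Rightarrow> 'a) set \<Rightarrow> bool" where
  "code_equiv n q C1 C2 \<longleftrightarrow> (\<exists>f1 f2 \<rho>.
     Lpoly_invertible n q f1 \<and> Lpoly_invertible n q f2 \<and> field_aut \<rho> \<and>
     C1 = {f1 \<circ> sigma_poly (frob q) n (\<rho> \<circ> a) \<circ> f2 | a. sigma_poly (frob q) n a \<in> C2})"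

lemma sigma_poly_twist:
  assumes "field_aut \<rho>" and "\<And>x. \<sigma> (\<rho> x) = \<rho> (\<sigma> x)"
  shows "sigma_poly \<sigma> n (\<rho> \<circ> a) = \<rho> \<circ> sigma_poly \<sigma> n a \<circ> inv \<rho>"
proof
  fix x
  have bij: "bij \<rho>" and add: "\<And>x y. \<rho> (x + y) = \<rho> x + \<rho> y"
    and mult: "\<And>x y. \<rho> (x * y) = \<rho> x * \<rho> y"
    using assms(1) by (auto simp: field_aut_def)
  have zero: "\<rho> 0 = 0" by (metis add add.right_neutral add_left_cancel)
  have sum: "\<rho> (\<Sum>i<m. g i) = (\<Sum>i<m. \<rho> (g i))" for m and g :: "nat \<Rightarrow> 'a"
    by (induction m) (simp_all add: zero add)
  have comm: "\<rho> ((\<sigma> ^^ i) y) = (\<sigma> ^^ i) (\<rho> y)" for i y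
    by (induction i) (simp_all add: assms(2)[symmetric])
  have "\<rho> (inv \<rho> x) = x" using bij by (simp add: bij_is_surj surj_f_inv_f)
  then show "sigma_poly \<sigma> n (\<rho> \<circ> a) x = (\<rho> \<circ> sigma_poly \<sigma> n a \<circ> inv \<rho>) x"
    by (simp add: sigma_poly_def sum mult comm)
qed

lemma frob_commute:
  assumes "field_aut \<rho>"
  shows "frob q (\<rho> x) = \<rho> (frob q x)"
  using assms by (induction q) (auto simp: frob_def field_aut_def)

definition psi :: "nat \<Rightarrow> ('a::field \<Rightarrow> 'a) \<Rightarrow> 'a \<Rightarrow> 'a \<Rightarrow> 'a" where
  "psi t \<sigma> h = (\<lambda>x. \<sigma> x + (\<sigma> ^^ (t - 1)) x + h * \<sigma> h * (\<sigma> ^^ (t + 1)) x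
      + h * inv \<sigma> (inverse h) * (\<sigma> ^^ (2 * t - 1)) x)"

text \<open>The span of \<open>x\<close> and \<open>\<psi>(x)\<close> under left multiplication by field elements.\<close>

definition code :: "nat \<Rightarrow> ('a::field \<Rightarrow> 'a) \<Rightarrow> 'a \<Rightarrow> ('a \<Rightarrow> 'a) set" where
  "code t \<sigma> h = {\<lambda>x. a * x + b * psi t \<sigma> h x | a b. True}"

text \<open>The norm from the field with \<open>q^(2 * t)\<close> elements to its subfield with \<open>q^t\<close> elements.\<close>

definition half_norm :: "nat \<Rightarrow> nat \<Rightarrow> 'a::field \<Rightarrow> 'a" where
  "half_norm q t h = h ^ (q ^ t + 1)"

definition codes :: "nat \<Rightarrow> nat \<Rightarrow> ('a::field \<Rightarrow> 'a) set set" where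
  "codes q t = {code t \<sigma> h | \<sigma> h. Gal_generator q \<sigma> \<and> half_norm q t h = -1}"

definition code_classes :: "nat \<Rightarrow> nat \<Rightarrow> ('a::field \<Rightarrow> 'a) set set set" where
  "code_classes q t = codes q t //
     {(C1, C2). C1 \<in> codes q t \<and> C2 \<in> codes q t \<and> code_equiv (2 * t) q C1 C2}"

end

theory Submission
  imports Defs "HOL-Number_Theory.Residues" "HOL-Computational_Algebra.Polynomial"
begin

text \<open>
  The scalars lie in every code and are its only left idealisers, so an equivalence between two codes is, up to a field
  automorphism, an identity placing \<open>\<psi>\<^sub>k \<circ> (a x + b \<psi>\<^sub>h)\<close> in the span of \<open>x\<close>
  and \<open>\<psi>\<^sub>h\<close>. Let \<open>\<sigma>\<close> be the power map with exponent \<open>q^s\<close> and grade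
  \<open>\<sigma>\<close>-polynomials by their Frobenius exponents modulo \<open>t\<close>. Then \<open>\<psi>\<^sub>h = U +
  V\<close> with \<open>U\<close> of degree \<open>s\<close> and \<open>V\<close> of degree \<open>- s\<close>; because the norm
  of \<open>h\<close> is \<open>- 1\<close>, neither \<open>U\<close> nor \<open>V\<close> is injective, their kernels meet
  trivially, and so do their images. Comparing degrees shows that the exponents \<open>s\<close> of the two generators agree up to
  sign modulo \<open>t\<close>, and that \<open>h \<sigma>\<^sup>2(h) = k \<sigma>\<^sup>2(k)\<close> when they are equal. The
  latter leaves at most \<open>q^2 + 1\<close> or \<open>2\<close> values for \<open>k / h\<close>, according to whether \<open>t
  mod 4 = 2\<close>, and there are at most \<open>2 r t\<close> field automorphisms.
\<close>

section \<open>Finite fields and their automorphisms\<close>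

lemma finite_field_primitive_element:
  obtains g :: "'a::{field,finite}" where "g \<noteq> 0" and "\<And>x. x \<noteq> 0 \<Longrightarrow> \<exists>k::nat. x = g ^ k"
proof -
  define R :: "'a ring" where
    "R = \<lparr>carrier = UNIV, monoid.mult = (*), one = 1, ring.zero = 0, add = (+)\<rparr>"
  have "\<exists>y. x + y = 0" for x :: 'a
    by (metis add.right_inverse)
  then have "cring R"
    by unfold_locales (auto simp: R_def Units_def algebra_simps)
  moreover have "\<exists>y. x * y = 1" if "x \<noteq> 0" for x :: 'a
    using that by (metis right_inverse)
  ultimately have "Ring.field R"
    by (intro cring.cring_fieldI) (auto simp: R_def Units_def mult.commute)
  moreover have "finite (carrier R)"
    by (simp add: R_def)
  ultimately obtain g where g: "g \<in> carrier (mult_of R)"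
    "carrier (mult_of R) = {g [^]\<^bsub>R\<^esub> i | i::nat. i \<in> UNIV}"
    using field.finite_field_mult_group_has_gen by blast
  have pow: "x [^]\<^bsub>R\<^esub> k = x ^ k" for x and k :: nat
    by (induction k) (simp_all add: R_def nat_pow_def mult.commute)
  have "\<exists>k. x = g ^ k" if "x \<noteq> 0" for x
  proof -
    have "carrier (mult_of R) = UNIV - {0}"
      by (simp add: R_def)
    then show ?thesis
      using that g(2) unfolding pow by blast
  qed
  moreover have "g \<noteq> 0"
    using g(1) by (simp add: R_def)
  ultimately show thesis
    using that by blast
qed

lemma finite_field_power_card_minus_one:
  fixes x :: "'a::{field,finite}"
  assumes "x \<noteq> 0"
  shows "x ^ (card (UNIV :: 'a set) - 1) = 1"
proof -
  let ?U = "UNIV - {0 :: 'a}"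
  have "bij_betw ((*) x) ?U ?U"
    by (rule bij_betwI[where g = "(*) (inverse x)"]) (use assms in auto)
  then have "(\<Prod>y\<in>?U. x * y) = \<Prod>?U"
    by (rule prod.reindex_bij_betw)
  then have "x ^ card ?U * \<Prod>?U = \<Prod>?U"
    by (simp add: prod.distrib)
  moreover have "\<Prod>?U \<noteq> 0"
    by (simp add: prod_zero_iff)
  ultimately show ?thesis
    by (simp add: card_Diff_singleton)
qed

lemma finite_field_power_card:
  fixes x :: "'a::{field,finite}"
  shows "x ^ card (UNIV :: 'a set) = x"
proof (cases "x = 0")
  case False
  have "x ^ Suc (card (UNIV :: 'a set) - 1) = x"
    by (simp only: power_Suc finite_field_power_card_minus_one[OF False] mult_1_right)
  then show ?thesis
    by (simp add: Suc_diff_1 finite_UNIV_card_ge_0)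
qed (simp add: finite_UNIV_card_ge_0)

lemma primitive_element_power_inj:
  fixes g :: "'a::{field,finite}"
  assumes "g \<noteq> 0" and gen: "\<And>x. x \<noteq> 0 \<Longrightarrow> \<exists>k::nat. x = g ^ k"
  shows "inj_on (\<lambda>k. g ^ k) {..<card (UNIV :: 'a set) - 1}"
proof (rule eq_card_imp_inj_on)
  let ?N = "card (UNIV :: 'a set) - 1"
  have "card {0, 1 :: 'a} \<le> card (UNIV :: 'a set)"
    by (rule card_mono) auto
  then have pos: "?N > 0"
    by simp
  have "x \<in> (\<lambda>k. g ^ k) ` {..<?N}" if x: "x \<noteq> 0" for x
  proof -
    obtain k where k: "x = g ^ k"
      using gen[OF x] by blast
    have "x = g ^ (?N * (k div ?N) + k mod ?N)"
      by (simp add: k)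
    also have "\<dots> = g ^ (k mod ?N)"
      by (simp only: power_add power_mult finite_field_power_card_minus_one[OF assms(1)] power_one mult_1)
    finally show ?thesis
      using pos by auto
  qed
  then have "(\<lambda>k. g ^ k) ` {..<?N} = UNIV - {0}"
    using assms(1) by auto
  then show "card ((\<lambda>k. g ^ k) ` {..<?N}) = card {..<?N}"
    by (simp add: card_Diff_singleton)
qed simp

lemma card_roots_power_le:
  fixes c :: "'a::idom"
  assumes "m > 0"
  shows "finite {x. x ^ m = c} \<and> card {x. x ^ m = c} \<le> m"
proof -
  let ?p = "Polynomial.monom 1 m + [:- c:]"
  have deg: "degree ?p = m"
    using assms degree_add_eq_left[of "[:-c:]" "Polynomial.monom 1 m"] by (simp add: degree_monom_eq)
  then have "?p \<noteq> 0"
    using assms by auto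
  moreover have "{x. poly ?p x = 0} = {x. x ^ m = c}"
    by (simp add: poly_monom)
  ultimately show ?thesis
    using poly_roots_finite[of ?p] card_poly_roots_bound[of ?p] deg by simp
qed

lemma map_poly_linear_factor:
  assumes "field_aut \<rho>"
  shows "map_poly \<rho> ([:- a, 1:] * f) = [:- \<rho> a, 1:] * map_poly \<rho> f"
proof -
  have add: "\<And>x y. \<rho> (x + y) = \<rho> x + \<rho> y"
    and mult: "\<And>x y. \<rho> (x * y) = \<rho> x * \<rho> y"
    using assms by (auto simp: field_aut_def)
  have zero: "\<rho> 0 = 0"
    by (metis add add.right_neutral add_left_cancel)
  have minus: "\<rho> (- x) = - \<rho> x" for x
    by (metis add zero add.right_inverse minus_unique)
  show ?thesis
    by (rule poly_eqI)
      (simp add: coeff_map_poly zero add mult minus coeff_pCons diff_conv_add_uminus split: nat.split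
        del: add_uminus_conv_diff)
qed

lemma map_poly_prod_linear_factors:
  assumes "field_aut \<rho>"
  shows "map_poly \<rho> (\<Prod>i<(m::nat). [:- a i, 1:]) = (\<Prod>i<m. [:- \<rho> (a i), 1:])"
proof (induction m)
  case 0
  then show ?case
    using assms by (simp add: field_aut_def map_poly_1)
next
  case (Suc m)
  then show ?case
    by (simp only: prod.lessThan_Suc mult.commute[of "prod _ _"] map_poly_linear_factor[OF assms])
qed

lemma field_aut_poly:
  assumes "field_aut \<rho>"
  shows "\<rho> (poly f x) = poly (map_poly \<rho> f) (\<rho> x)"
proof -
  have add: "\<And>x y. \<rho> (x + y) = \<rho> x + \<rho> y"
    and mult: "\<And>x y. \<rho> (x * y) = \<rho> x * \<rho> y"
    using assms by (auto simp: field_aut_def)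
  have zero: "\<rho> 0 = 0"
    by (metis add add.right_neutral add_left_cancel)
  show ?thesis
  proof (induction f)
    case (pCons a f)
    have "map_poly \<rho> (pCons a f) = pCons (\<rho> a) (map_poly \<rho> f)"
      by (rule poly_eqI) (simp add: coeff_map_poly zero coeff_pCons split: nat.split)
    with pCons show ?case
      by (simp add: add mult)
  qed (simp add: zero)
qed

lemma field_aut_power:
  assumes "field_aut \<rho>"
  shows "\<rho> (x ^ m) = \<rho> x ^ m"
  using assms by (induction m) (auto simp: field_aut_def)

locale finite_field_frobenius =
  fixes ty :: "'a::{field,finite} itself" and q n :: nat
  assumes q_ge_2: "q \<ge> 2" and n_pos: "n > 0"
    and card_field: "card (UNIV :: 'a set) = q ^ n"
    and power_q_add: "(x + y :: 'a) ^ q = x ^ q + y ^ q"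
begin

definition fr :: "int \<Rightarrow> 'a \<Rightarrow> 'a" where
  "fr j x = x ^ (q ^ nat (j mod int n))"

lemma power_q_n: "(x :: 'a) ^ (q ^ n) = x"
  using finite_field_power_card[of x] by (simp add: card_field)

lemma fr_of_nat: "fr (int k) x = x ^ (q ^ k)"
proof -
  have "x ^ (q ^ (n * m)) = x" for m
    by (induction m) (simp_all add: power_add power_mult power_q_n)
  then have "x ^ (q ^ (n * (k div n) + k mod n)) = x ^ (q ^ (k mod n))"
    unfolding power_add power_mult by simp
  then show ?thesis
    by (simp add: fr_def flip: zmod_int)
qed

lemma fr_cong: "int n dvd i - j \<Longrightarrow> fr i x = fr j x"
  by (simp add: fr_def flip: mod_eq_dvd_iff)

lemma fr_eq_of_nat: "fr j x = fr (int (nat (j mod int n))) x"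
  by (rule fr_cong) (use n_pos in \<open>simp add: minus_mod_eq_div_mult [symmetric] mod_eq_dvd_iff[symmetric]\<close>)

lemma fr_fr [simp]: "fr i (fr j x) = fr (i + j) x"
proof -
  have "fr i (fr j x) = fr (int (nat (j mod int n) + nat (i mod int n))) x"
    unfolding fr_of_nat by (simp add: fr_def power_add power_mult)
  also have "\<dots> = fr (i + j) x"
    using n_pos by (intro fr_cong) (simp add: mod_eq_dvd_iff[symmetric] mod_simps add.commute)
  finally show ?thesis .
qed

lemma fr_0 [simp]: "fr 0 x = x"
  using fr_of_nat[of 0] by simp

lemma fr_zero [simp]: "fr j 0 = 0" and fr_one [simp]: "fr j 1 = 1"
  and fr_mult: "fr j (x * y) = fr j x * fr j y"
  and fr_divide: "fr j (x / y) = fr j x / fr j y"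
  and fr_inverse: "fr j (inverse x) = inverse (fr j x)"
  and fr_power: "fr j (x ^ m) = fr j x ^ m"
  using q_ge_2 by (simp_all add: fr_def power_mult_distrib power_divide power_inverse
      flip: power_mult) (simp_all add: mult.commute)

lemma fr_add: "fr j (x + y) = fr j x + fr j y"
proof -
  have "(x + y) ^ (q ^ m) = x ^ (q ^ m) + y ^ (q ^ m)" for m
    by (induction m arbitrary: x y) (simp_all add: power_mult power_q_add)
  then show ?thesis
    by (simp add: fr_def)
qed

lemma fr_minus: "fr j (- x) = - fr j x"
  by (metis fr_add fr_zero add.right_inverse minus_unique)

lemma fr_eq_0_iff [simp]: "fr j x = 0 \<longleftrightarrow> x = 0"
  using q_ge_2 by (auto simp: fr_def)

lemma fr_funpow: "fr j ^^ k = fr (int k * j)"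
proof (induction k)
  case (Suc k)
  show ?case
    by (auto simp: Suc distrib_right)
qed auto

lemma bij_fr: "bij (fr j)"
  by (rule o_bij[of "fr (- j)"]) auto

lemma inv_fr: "Hilbert_Choice.inv (fr j) = fr (- j)"
  by (rule inv_unique_comp) auto

lemma frob_eq_fr: "frob q = fr 1"
  using fr_of_nat[of 1] by (auto simp: frob_def)

lemma field_aut_fr: "field_aut (fr j)"
  by (simp add: field_aut_def bij_fr fr_add fr_mult)

lemma fr_in_Gal: "fr j \<in> Gal q"
proof -
  have "x ^ (q ^ m) = x" if "x ^ q = x" for x :: 'a and m
    by (induction m) (simp_all add: power_mult that)
  then show ?thesis
    by (auto simp: Gal_def field_aut_fr fr_def)
qed

lemma field_aut_fr_commute: "field_aut \<rho> \<Longrightarrow> \<rho> (fr j x) = fr j (\<rho> x)"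
  by (simp add: fr_def field_aut_power)

text \<open>The polynomial whose roots are the conjugates of a primitive element has coefficients
  in the fixed field, hence every automorphism permutes its roots.\<close>

lemma Gal_imp_fr:
  fixes \<tau> :: "'a \<Rightarrow> 'a"
  assumes "\<tau> \<in> Gal q"
  obtains i where "i < n" and "\<tau> = fr (int i)"
proof -
  obtain g :: 'a where g: "g \<noteq> 0" "\<And>x. x \<noteq> 0 \<Longrightarrow> \<exists>k::nat. x = g ^ k"
    using finite_field_primitive_element by blast
  have aut: "field_aut \<tau>" and fixed: "\<And>x. x ^ q = x \<Longrightarrow> \<tau> x = x"
    using assms by (auto simp: Gal_def)
  define F where "F i = [:- fr (int i) g, 1:]" for i :: nat
  define f where "f = (\<Prod>i<n. F i)"
  obtain m where m: "n = Suc m"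
    using n_pos gr0_conv_Suc by blast
  have "fr (int (Suc m)) g = fr (int 0) g"
    by (rule fr_cong) (simp add: m)
  then have last: "F (Suc m) = F 0"
    by (simp only: F_def)
  have "map_poly (fr 1) f = (\<Prod>i<n. F (Suc i))"
    unfolding f_def F_def map_poly_prod_linear_factors[OF field_aut_fr] by simp
  also have "\<dots> = f"
    unfolding f_def m prod.lessThan_Suc_shift[of F] prod.lessThan_Suc[of "\<lambda>i. F (Suc i)"] last
    by (rule mult.commute)
  finally have "fr 1 (coeff f i) = coeff f i" for i
    by (metis coeff_map_poly fr_zero)
  then have "\<tau> (coeff f i) = coeff f i" for i
    using fixed[of "coeff f i"] frob_eq_fr by (metis frob_def)
  then have "map_poly \<tau> f = f"
    by (intro poly_eqI) (metis coeff_map_poly fixed fr_one fr_zero frob_def frob_eq_fr)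
  moreover have "poly f g = 0"
    unfolding f_def F_def poly_prod using n_pos by (auto intro!: prod_zero bexI[of _ 0])
  ultimately have "poly f (\<tau> g) = 0"
    using field_aut_poly[OF aut, of f g] fixed[of 0] q_ge_2 by simp
  then obtain i where i: "i < n" "\<tau> g = fr (int i) g"
    unfolding f_def F_def poly_prod by auto
  have "\<tau> x = fr (int i) x" for x
  proof (cases "x = 0")
    case True
    then show ?thesis
      using fixed[of 0] q_ge_2 by simp
  next
    case False
    then obtain k where "x = g ^ k"
      using g(2) by blast
    then show ?thesis
      by (simp add: field_aut_power[OF aut] fr_power i(2))
  qed
  then show thesis
    using that i(1) by blast
qed

lemma Gal_generator_fr:
  assumes "coprime s (int n)"
  shows "Gal_generator q (fr s)"
  unfolding Gal_generator_def
proof (intro conjI ballI)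
  show "fr s \<in> Gal q"
    by (rule fr_in_Gal)
  fix \<tau> :: "'a \<Rightarrow> 'a"
  assume "\<tau> \<in> Gal q"
  then obtain i where i: "\<tau> = fr (int i)"
    using Gal_imp_fr by blast
  obtain y where y: "[s * y = 1] (mod int n)"
    using cong_solve_coprime_int[OF assms] by blast
  define k where "k = nat ((int i * y) mod int n)"
  have "[int k * s = int i * y * s] (mod int n)"
    unfolding k_def using n_pos by (simp add: cong_def mod_simps)
  also have "[int i * y * s = int i * 1] (mod int n)"
    using cong_mult[OF cong_refl y, of "int i"] by (simp add: ac_simps)
  finally have "fr (int i) = fr (int k * s)"
    by (auto intro!: fr_cong simp: cong_iff_dvd_diff dvd_diff_commute)
  then have "\<tau> = fr s ^^ k"
    by (simp add: i fr_funpow)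
  then show "\<exists>k. \<tau> = fr s ^^ k" ..
qed

lemma poly_zero_on_field:
  fixes P :: "'a poly"
  assumes "degree P < q ^ n" and "\<And>x. poly P x = 0"
  shows "P = 0"
  using card_poly_roots_bound[of P] assms card_field by fastforce

end

lemma CHAR_eq_prime:
  assumes "card (UNIV :: 'a::{field,finite} set) = p ^ m" and "prime p"
  shows "CHAR('a) = p"
proof -
  have "prime CHAR('a)"
    by (rule prime_CHAR_semidom) (simp add: finite_imp_CHAR_pos)
  moreover have "CHAR('a) dvd p ^ m"
    using CHAR_dvd_CARD[where ?'a = 'a] assms by simp
  ultimately show ?thesis
    using assms(2) prime_dvd_power primes_dvd_imp_eq by blast
qed

lemma field_aut_in_Gal_prime:
  fixes \<omega> :: "'a::{field,finite} \<Rightarrow> 'a"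
  assumes "card (UNIV :: 'a set) = p ^ m" and "prime p" and "field_aut \<omega>"
  shows "\<omega> \<in> Gal p"
proof -
  have char: "CHAR('a) = p"
    using CHAR_eq_prime assms by blast
  have p: "p > 0"
    using assms(2) by (simp add: prime_gt_0_nat)
  have fermat: "(of_nat k :: 'a) ^ p = of_nat k" for k
    by (induction k) (use p assms(2) in \<open>auto simp: freshmans_dream[where ?'a = 'a] char power_0_left\<close>)
  have "inj_on (of_nat :: nat \<Rightarrow> 'a) {..<p}"
    by (rule inj_onI) (simp add: of_nat_eq_iff_cong_CHAR char cong_less_modulus_unique_nat)
  then have "card (of_nat ` {..<p} :: 'a set) = p"
    by (simp add: card_image)
  moreover have "of_nat ` {..<p} \<subseteq> {x :: 'a. x ^ p = x}"
    using fermat by auto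
  moreover have "card {x :: 'a. x ^ p = x} \<le> p"
  proof -
    let ?P = "Polynomial.monom 1 p + [:0, - 1 :: 'a:]"
    have "p > 1"
      using assms(2) prime_gt_1_nat by blast
    then have "degree ?P = p"
      using degree_add_eq_left[of "[:0, - 1 :: 'a:]" "Polynomial.monom 1 p"] by (simp add: degree_monom_eq)
    then have "card {x. poly ?P x = 0} \<le> p"
      using card_poly_roots_bound[of ?P] p by fastforce
    then show ?thesis
      by (simp add: poly_monom)
  qed
  ultimately have prime_field: "of_nat ` {..<p} = {x :: 'a. x ^ p = x}"
    by (intro card_seteq) auto
  have one: "\<omega> 1 = 1" and add: "\<And>x y. \<omega> (x + y) = \<omega> x + \<omega> y"
    using assms(3) by (auto simp: field_aut_def)
  have "\<omega> 0 = 0"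
    by (metis add add.right_neutral add_left_cancel)
  then have "\<omega> (of_nat k) = of_nat k" for k
    by (induction k) (simp_all add: add one)
  then have "\<omega> x = x" if "x ^ p = x" for x
  proof -
    have "x \<in> of_nat ` {..<p}"
      unfolding prime_field using that by simp
    then show ?thesis
      using \<open>\<And>k. \<omega> (of_nat k) = of_nat k\<close> by blast
  qed
  then show ?thesis
    using assms(3) by (simp add: Gal_def)
qed

section \<open>The grading modulo half the degree\<close>

locale even_degree_frobenius = finite_field_frobenius ty q n
  for ty :: "'a::{field,finite} itself" and q n :: nat +
  fixes t :: nat
  assumes n_eq: "n = 2 * t" and t_ge_5: "t \<ge> 5" and two_neq_0: "(2 :: 'a) \<noteq> 0"
begin

lemma fr_cong_2t: "2 * int t dvd i - j \<Longrightarrow> fr i x = fr j x"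
  by (rule fr_cong) (simp add: n_eq)

text \<open>Degrees are taken modulo \<open>t\<close>, not \<open>2 * t\<close>: the exponents \<open>e\<close> and \<open>e + t\<close> share one
  component.\<close>

definition gr :: "int \<Rightarrow> ('a \<Rightarrow> 'a) set" where
  "gr e = {f. \<exists>\<alpha> \<beta>. \<forall>x. f x = \<alpha> * fr e x + \<beta> * fr (e + int t) x}"

lemma grI: "(\<And>x. f x = \<alpha> * fr e x + \<beta> * fr (e + int t) x) \<Longrightarrow> f \<in> gr e"
  by (auto simp: gr_def)

lemma gr_scale: "f \<in> gr e \<Longrightarrow> (\<lambda>x. c * f x) \<in> gr e"
  unfolding gr_def by (force simp: distrib_left mult.assoc[symmetric])

lemma gr_mult_arg: "f \<in> gr e \<Longrightarrow> (\<lambda>x. f (c * x)) \<in> gr e"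
  unfolding gr_def by (force simp: fr_mult mult.assoc[symmetric])

lemma gr_comp:
  assumes "f \<in> gr e" and "g \<in> gr e'"
  shows "(\<lambda>x. f (g x)) \<in> gr (e + e')"
proof -
  obtain \<alpha> \<beta> where f: "\<And>x. f x = \<alpha> * fr e x + \<beta> * fr (e + int t) x"
    using assms(1) by (auto simp: gr_def)
  obtain \<alpha>' \<beta>' where g: "\<And>x. g x = \<alpha>' * fr e' x + \<beta>' * fr (e' + int t) x"
    using assms(2) by (auto simp: gr_def)
  have 1: "fr (e + int t + (e' + int t)) x = fr (e + e') x" for x
    by (rule fr_cong_2t) simp
  have 2: "fr (e + int t + e') x = fr (e + e' + int t) x" "fr (e + (e' + int t)) x = fr (e + e' + int t) x" for x
    by (simp_all add: ac_simps)
  show ?thesis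
    by (rule grI[of _ "\<alpha> * fr e \<alpha>' + \<beta> * fr (e + int t) \<beta>'" _ "\<alpha> * fr e \<beta>' + \<beta> * fr (e + int t) \<alpha>'"])
      (simp only: f g fr_mult fr_add fr_fr 1 2, simp only: algebra_simps)
qed

lemma gr_fr: "fr e \<in> gr e"
  by (rule grI[of _ 1 _ 0]) simp

lemma exists_fr_t_neq: "\<exists>x. fr (int t) x \<noteq> x"
proof (rule ccontr)
  assume "\<nexists>x. fr (int t) x \<noteq> x"
  then have fixed: "x ^ (q ^ t) = x" for x :: 'a
    by (simp add: fr_of_nat)
  let ?P = "Polynomial.monom 1 (q ^ t) + [:0, - 1 :: 'a:]"
  have "q ^ t > q ^ 0"
    using q_ge_2 t_ge_5 by (intro power_strict_increasing) auto
  then have qt: "q ^ t > 1"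
    by simp
  then have deg: "degree ?P = q ^ t"
    using degree_add_eq_left[of "[:0, - 1 :: 'a:]" "Polynomial.monom 1 (q ^ t)"]
    by (simp add: degree_monom_eq)
  have "q ^ t < q ^ n"
    using q_ge_2 t_ge_5 n_eq by (intro power_strict_increasing) auto
  then have "?P = 0"
    by (intro poly_zero_on_field) (simp_all add: deg poly_monom fixed)
  then show False
    using deg qt by (metis degree_0 not_one_less_zero)
qed

lemma gr_indep:
  assumes "\<And>x. \<alpha> * fr e x + \<beta> * fr (e + int t) x = 0"
  shows "\<alpha> = 0 \<and> \<beta> = 0"
proof -
  obtain y where y: "fr (int t) y \<noteq> y"
    using exists_fr_t_neq by blast
  have "\<beta> = - \<alpha>"
    using assms[of 1] by (simp add: add_eq_0_iff)
  then have "\<alpha> * (y - fr (int t) y) = 0"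
    using assms[of "fr (- e) y"] by (simp add: algebra_simps)
  then show ?thesis
    using y \<open>\<beta> = - \<alpha>\<close> by simp
qed

text \<open>The sums below are polynomial functions of degree less than \<open>q ^ n\<close>, hence determined by
  their coefficients.\<close>

lemma gr_select:
  fixes L :: "(('a \<Rightarrow> 'a) \<times> int) list"
  assumes "\<forall>(f, e) \<in> set L. f \<in> gr e"
    and "\<And>x. (\<Sum>(f, e) \<leftarrow> L. f x) = 0"
  shows "(\<Sum>(f, e) \<leftarrow> filter (\<lambda>(f, e). int t dvd e - d) L. f x) = 0"
proof -
  define S where "S m \<longleftrightarrow> (\<exists>k. m = q ^ k \<and> int t dvd int k - d)" for m :: nat
  have S_power: "S (q ^ k) \<longleftrightarrow> int t dvd int k - d" for k
    using q_ge_2 by (auto simp: S_def)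
  have "\<exists>P Q :: 'a poly. degree P < q ^ n \<and> (\<forall>x. (\<Sum>(f, e) \<leftarrow> L. f x) = poly P x) \<and>
      (\<forall>x. (\<Sum>(f, e) \<leftarrow> filter (\<lambda>(f, e). int t dvd e - d) L. f x) = poly Q x) \<and>
      (\<forall>m. coeff Q m = (if S m then coeff P m else 0))"
    using assms(1)
  proof (induction L)
    case Nil
    show ?case
      by (intro exI[of _ 0]) (use q_ge_2 in auto)
  next
    case (Cons fe L)
    obtain f e where fe: "fe = (f, e)"
      by (cases fe)
    obtain P Q :: "'a poly" where PQ: "degree P < q ^ n"
      "\<And>x. (\<Sum>(f, e) \<leftarrow> L. f x) = poly P x"
      "\<And>x. (\<Sum>(f, e) \<leftarrow> filter (\<lambda>(f, e). int t dvd e - d) L. f x) = poly Q x"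
      "\<And>m. coeff Q m = (if S m then coeff P m else 0)"
      using Cons by auto
    have "f \<in> gr e"
      using Cons.prems by (simp add: fe)
    then obtain \<alpha> \<beta> where f: "\<And>x. f x = \<alpha> * fr e x + \<beta> * fr (e + int t) x"
      by (auto simp: gr_def)
    define a b where "a = nat (e mod int n)" and "b = nat ((e + int t) mod int n)"
    define P0 where "P0 = Polynomial.monom \<alpha> (q ^ a) + Polynomial.monom \<beta> (q ^ b)"
    have f_poly: "f x = poly P0 x" for x
      by (simp add: f P0_def poly_monom fr_def a_def b_def)
    have ab: "a < n" "b < n"
      unfolding a_def b_def using n_pos by (simp_all add: nat_less_iff)
    then have deg0: "degree P0 < q ^ n"
      unfolding P0_def using q_ge_2
      by (intro degree_add_less) (auto intro!: le_less_trans[OF degree_monom_le] power_strict_increasing)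
    have mod_eq: "int (nat (i mod int n)) = i - int t * (2 * (i div int n))" for i
    proof -
      have "int (nat (i mod int n)) = i mod int n"
        using n_pos by simp
      also have "\<dots> = i - int n * (i div int n)"
        by (rule minus_mult_div_eq_mod[symmetric])
      finally show ?thesis
        by (simp add: n_eq)
    qed
    have "int a = e - int t * (2 * (e div int n))"
      unfolding a_def by (rule mod_eq)
    moreover have "int b = e - int t * (2 * ((e + int t) div int n) - 1)"
      unfolding b_def mod_eq by (simp add: algebra_simps)
    moreover have "int t dvd e - int t * k - d \<longleftrightarrow> int t dvd e - d" for k
    proof -
      have "e - int t * k - d = (e - d) + int t * (- k)"
        by simp
      then show ?thesis
        by (simp only: dvd_add_left_iff[OF dvd_triv_left])
    qed
    ultimately have Sab: "S (q ^ a) \<longleftrightarrow> int t dvd e - d" "S (q ^ b) \<longleftrightarrow> int t dvd e - d"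
      unfolding S_power by simp_all
    have coeff0: "coeff P0 m = 0" if "S m \<noteq> (int t dvd e - d)" for m
      using that Sab by (auto simp: P0_def)
    show ?case
    proof (intro exI conjI allI)
      show "degree (P0 + P) < q ^ n"
        by (rule degree_add_less[OF deg0 PQ(1)])
      show "(\<Sum>(f, e) \<leftarrow> fe # L. f x) = poly (P0 + P) x" for x
        by (simp add: fe f_poly PQ(2))
      show "(\<Sum>(f, e) \<leftarrow> filter (\<lambda>(f, e). int t dvd e - d) (fe # L). f x) =
          poly ((if int t dvd e - d then P0 else 0) + Q) x" for x
        by (simp add: fe f_poly PQ(3))
      show "coeff ((if int t dvd e - d then P0 else 0) + Q) m =
          (if S m then coeff (P0 + P) m else 0)" for m
        using coeff0[of m] by (auto simp: PQ(4))
    qed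
  qed
  then obtain P Q :: "'a poly" where PQ: "degree P < q ^ n"
    "\<And>x. (\<Sum>(f, e) \<leftarrow> L. f x) = poly P x"
    "\<And>x. (\<Sum>(f, e) \<leftarrow> filter (\<lambda>(f, e). int t dvd e - d) L. f x) = poly Q x"
    "\<And>m. coeff Q m = (if S m then coeff P m else 0)"
    by blast
  have "P = 0"
    by (rule poly_zero_on_field[OF PQ(1)]) (simp add: assms(2) flip: PQ(2))
  then have "Q = 0"
    by (intro poly_eqI) (simp add: PQ(4))
  then show ?thesis
    by (simp add: PQ(3))
qed

subsection \<open>Elements of norm minus one\<close>

lemma fr_multiple_fixed:
  assumes "fr j u = u"
  shows "fr (m * j) u = u"
proof -
  have pos: "fr (int l * j) u = u" if "fr j u = u" for l j
    using that by (induction l) (simp_all add: distrib_right flip: fr_fr)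
  have "fr (- j) u = u"
    by (metis assms fr_0 fr_fr add.left_inverse)
  then show ?thesis
    using pos[OF assms] pos[of "- j"] by (cases m rule: int_cases2) auto
qed

lemma fr_multiple_inverse:
  assumes "fr j u = inverse u"
  shows "fr (m * j) u = (if even m then u else inverse u)"
proof -
  have *: "fr (2 * j) u = u"
    using assms fr_fr[of j j u] by (simp add: fr_inverse)
  show ?thesis
  proof (cases "even m")
    case True
    then obtain l where "m = l * 2"
      by (auto elim: evenE simp: mult.commute)
    then show ?thesis
      using fr_multiple_fixed[OF *, of l] by (simp add: mult.assoc)
  next
    case False
    then obtain l where "m = 2 * l + 1"
      by (auto elim: oddE)
    then have "fr (m * j) u = fr j (fr (l * (2 * j)) u)"
      by (simp add: algebra_simps)
    then show ?thesis
      using False fr_multiple_fixed[OF *, of l] assms by simp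
  qed
qed

lemma fr_t_times_odd: "odd s \<Longrightarrow> fr (s * int t) x = fr (int t) x"
  by (rule fr_cong_2t) (auto elim!: oddE simp: algebra_simps)

lemma inverse_twist_cases:
  assumes "fr (2 * s) u = inverse u" and "odd s"
  shows "odd t \<Longrightarrow> inverse u = u" and "t mod 4 = 2 \<Longrightarrow> fr (int t) u = inverse u"
    and "t mod 4 = 0 \<Longrightarrow> fr (int t) u = u"
proof -
  note * = fr_multiple_inverse[OF assms(1)]
  show "inverse u = u" if "odd t"
  proof -
    have "fr (int t * (2 * s)) u = fr 0 u"
      by (rule fr_cong_2t) simp
    then show ?thesis
      using *[of "int t"] that by simp
  qed
  have half: "fr (int t) u = fr (int (t div 2) * (2 * s)) u" if "even t"
  proof -
    have "int (t div 2) * (2 * s) = s * int t"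
      using that by (auto elim!: evenE)
    then show ?thesis
      using fr_t_times_odd[OF assms(2)] by metis
  qed
  show "fr (int t) u = inverse u" if "t mod 4 = 2"
  proof -
    have "even t" "odd (t div 2)"
      using that by presburger+
    then show ?thesis
      using half *[of "int (t div 2)"] by simp
  qed
  show "fr (int t) u = u" if "t mod 4 = 0"
  proof -
    have "even t" "even (t div 2)"
      using that by presburger+
    then show ?thesis
      using half *[of "int (t div 2)"] by simp
  qed
qed

definition skew_unit :: "'a \<Rightarrow> bool" where
  "skew_unit h \<longleftrightarrow> h * fr (int t) h = - 1"

lemma half_norm_eq: "half_norm q t h = - 1 \<longleftrightarrow> skew_unit h"
  by (simp add: half_norm_def skew_unit_def fr_of_nat power_add mult.commute)

lemma skew_unit_nonzero: "skew_unit h \<Longrightarrow> h \<noteq> 0"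
  by (auto simp: skew_unit_def)

lemma skew_unit_conj:
  assumes "skew_unit h"
  shows "fr (int t) h = - inverse h"
proof -
  have "h \<noteq> 0"
    by (rule skew_unit_nonzero[OF assms])
  then show ?thesis
    using assms unfolding skew_unit_def by (simp add: field_simps)
qed

lemma one_neq_minus_one: "(1 :: 'a) \<noteq> - 1"
  using two_neq_0 by (metis add.right_inverse one_add_one)

lemma skew_unit_twist:
  assumes "skew_unit h" and "odd s"
  shows "h * fr (2 * s) h \<noteq> 1"
proof
  assume 1: "h * fr (2 * s) h = 1"
  have h: "h \<noteq> 0" "h * fr (int t) h = - 1"
    using assms(1) skew_unit_nonzero by (auto simp: skew_unit_def)
  have inv: "fr (2 * s) h = inverse h"
    using 1 by (metis inverse_unique)
  note cases = inverse_twist_cases[OF inv assms(2)]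
  have "odd t \<or> t mod 4 = 2 \<or> t mod 4 = 0"
    by presburger
  then consider "odd t" | "t mod 4 = 2" | "t mod 4 = 0"
    by metis
  then show False
  proof cases
    case 1
    then have "h * h = 1"
      using cases(1) h(1) by (metis right_inverse)
    then have "h = 1 \<or> h = - 1"
      by (rule square_eq_1_iff[THEN iffD1])
    then have "fr (int t) h = h"
      by (auto simp: fr_minus)
    then show False
      using h \<open>h * h = 1\<close> one_neq_minus_one by simp
  next
    case 2
    then show False
      using cases(2) h one_neq_minus_one by simp
  next
    case 3
    then have sq: "h * h = - 1"
      using cases(3) h by simp
    then have "fr 1 h * fr 1 h = h * h"
      by (metis fr_minus fr_mult fr_one)
    then have "fr 1 h = h \<or> fr 1 h = - h"
      by (simp add: square_eq_iff)
    moreover have "fr 2 h = fr 1 (fr 1 h)"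
      by simp
    ultimately have "fr 2 h = h"
      by (metis fr_minus minus_minus)
    then have "fr (2 * s) h = h"
      using fr_multiple_fixed[of 2 h s] by (simp add: mult.commute)
    then have "h * h = 1"
      using 1 \<open>h * fr (2 * s) h = 1\<close> by simp
    then show False
      using sq one_neq_minus_one by simp
  qed
qed

text \<open>The hypotheses below are those satisfied, up to a field automorphism, by the ratio \<open>u\<close> of
  two parameters that give equivalent codes for the same generator.\<close>

lemma twist_ratio_square:
  assumes "u * fr (2 * s) u = 1" and "u * fr (int t) u = 1" and "odd s" and "t mod 4 \<noteq> 2"
  shows "u ^ 2 = 1"
proof -
  have inv: "fr (2 * s) u = inverse u"
    using assms(1) by (metis inverse_unique)
  have "u \<noteq> 0"
    using assms(1) by auto
  have "odd t \<or> t mod 4 = 0"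
    using assms(4) by presburger
  then consider "odd t" | "t mod 4 = 0"
    by metis
  then show ?thesis
  proof cases
    case 1
    then show ?thesis
      using inverse_twist_cases(1)[OF inv assms(3)] \<open>u \<noteq> 0\<close>
      by (metis power2_eq_square right_inverse)
  next
    case 2
    then show ?thesis
      using inverse_twist_cases(3)[OF inv assms(3)] assms(2) by (simp add: power2_eq_square)
  qed
qed

lemma twist_ratio_power:
  assumes "u * fr (2 * s) u = 1" and "u * fr (int t) u = 1" and "coprime s (int n)" and "t mod 4 = 2"
  shows "u ^ (q ^ 2 + 1) = 1"
proof -
  have inv: "fr (2 * s) u = inverse u" "fr (int t) u = inverse u"
    using assms(1,2) by (metis inverse_unique)+
  have "u \<noteq> 0"
    using assms(1) by auto
  define t' where "t' = int t div 2"
  have t': "int t = 2 * t'" "odd t'"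
    using assms(4) unfolding t'_def by presburger+
  have "coprime s (2 * (2 * t'))"
    using assms(3) by (simp add: n_eq t'(1))
  then have "odd s" and "coprime s t'"
    by (auto simp: coprime_commute)
  obtain x y where xy: "x * s + y * t' = 1"
    using \<open>coprime s t'\<close> bezout_int[of s t'] by (metis coprime_iff_gcd_eq_1)
  then have parity: "even x \<longleftrightarrow> odd y"
    using \<open>odd s\<close> \<open>odd t'\<close> by (metis even_add even_mult_iff odd_one)
  have "2 = x * (2 * s) + y * int t"
    using xy unfolding t'(1) by (simp add: algebra_simps)
  then have "fr 2 u = fr (x * (2 * s)) (fr (y * int t) u)"
    by simp
  also have "\<dots> = inverse u"
    using parity by (simp add: fr_multiple_inverse[OF inv(1)] fr_multiple_inverse[OF inv(2)] fr_inverse)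
  finally have "u ^ (q ^ 2) = inverse u"
    using fr_of_nat[of 2 u] by simp
  then show ?thesis
    using \<open>u \<noteq> 0\<close> by (simp add: power_add)
qed

subsection \<open>Compositions of the defining maps\<close>

lemma fr_diff: "fr j (x - y) = fr j x - fr j y"
  unfolding diff_conv_add_uminus fr_add fr_minus ..

definition wcoef :: "int \<Rightarrow> 'a \<Rightarrow> 'a" where
  "wcoef s h = h * fr s h"

definition vcoef :: "int \<Rightarrow> 'a \<Rightarrow> 'a" where
  "vcoef s h = h * fr (- s) (inverse h)"

definition psi_pos :: "int \<Rightarrow> 'a \<Rightarrow> 'a \<Rightarrow> 'a" where
  "psi_pos s h x = fr s x + wcoef s h * fr (s + int t) x"

definition psi_neg :: "int \<Rightarrow> 'a \<Rightarrow> 'a \<Rightarrow> 'a" where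
  "psi_neg s h x = fr (int t - s) x + vcoef s h * fr (- s) x"

lemma psi_decomp:
  assumes "odd s"
  shows "psi t (fr s) h x = psi_pos s h x + psi_neg s h x"
proof -
  obtain k where k: "s = 2 * k + 1"
    using assms by (auto elim: oddE)
  have 1: "fr (int (t - 1) * s) x = fr (int t - s) x"
    using t_ge_5 by (intro fr_cong_2t) (simp add: k of_nat_diff algebra_simps)
  have 2: "fr (int (t + 1) * s) x = fr (s + int t) x"
    by (intro fr_cong_2t) (simp add: k algebra_simps)
  have 3: "fr (int (2 * t - 1) * s) x = fr (- s) x"
    using t_ge_5 by (intro fr_cong_2t) (simp add: of_nat_diff algebra_simps)
  show ?thesis
    unfolding psi_def fr_funpow inv_fr psi_pos_def psi_neg_def wcoef_def vcoef_def 1 2 3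
    by (simp only: ac_simps)
qed

lemma gr_psi_pos: "psi_pos s h \<in> gr s"
  by (rule grI[of _ 1 _ "wcoef s h"]) (simp add: psi_pos_def)

lemma gr_psi_neg: "psi_neg s h \<in> gr (- s)"
  by (rule grI[of _ "vcoef s h" _ 1]) (simp add: psi_neg_def)

lemma psi_pos_add: "psi_pos s h (x + y) = psi_pos s h x + psi_pos s h y"
  by (simp add: psi_pos_def fr_add algebra_simps)

lemma psi_neg_add: "psi_neg s h (x + y) = psi_neg s h x + psi_neg s h y"
  by (simp add: psi_neg_def fr_add algebra_simps)

lemma psi_pos_zero [simp]: "psi_pos s h 0 = 0"
  by (simp add: psi_pos_def)

lemma psi_neg_zero [simp]: "psi_neg s h 0 = 0"
  by (simp add: psi_neg_def)

lemma fr_t_wcoef: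
  assumes "skew_unit h"
  shows "fr (int t) (wcoef s h) = inverse (wcoef s h)"
proof -
  have "fr (int t) (wcoef s h) = fr (int t) h * fr s (fr (int t) h)"
    by (simp add: wcoef_def fr_mult add.commute)
  then show ?thesis
    by (simp add: skew_unit_conj[OF assms] fr_minus fr_inverse wcoef_def)
qed

lemma fr_t_vcoef:
  assumes "skew_unit h"
  shows "fr (int t) (vcoef s h) = inverse (vcoef s h)"
proof -
  have "fr (int t) (vcoef s h) = fr (int t) h * inverse (fr (- s) (fr (int t) h))"
    by (simp add: vcoef_def fr_mult fr_inverse add.commute)
  then show ?thesis
    by (simp add: skew_unit_conj[OF assms] fr_minus fr_inverse vcoef_def)
qed

lemma wcoef_nonzero: "skew_unit h \<Longrightarrow> wcoef s h \<noteq> 0"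
  and vcoef_nonzero: "skew_unit h \<Longrightarrow> vcoef s h \<noteq> 0"
  using skew_unit_nonzero by (auto simp: wcoef_def vcoef_def)

lemma fr_t_t [simp]: "fr (int t + (int t + e)) x = fr e x"
  by (rule fr_cong_2t) simp

lemma psi_pos_range:
  assumes "skew_unit h"
  shows "psi_pos s h x = wcoef s h * fr (int t) (psi_pos s h x)"
proof -
  have "fr (int t) (psi_pos s h x) = fr (s + int t) x + inverse (wcoef s h) * fr s x"
    using fr_t_t[of s x] by (simp add: psi_pos_def fr_add fr_mult fr_t_wcoef[OF assms] ac_simps)
  then show ?thesis
    using wcoef_nonzero[OF assms] by (simp add: psi_pos_def algebra_simps)
qed

lemma psi_neg_range:
  assumes "skew_unit h"
  shows "psi_neg s h x = vcoef s h * fr (int t) (psi_neg s h x)"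
proof -
  have "fr (int t) (psi_neg s h x) = fr (- s) x + inverse (vcoef s h) * fr (int t - s) x"
    using fr_t_t[of "- s" x] by (simp add: psi_neg_def fr_add fr_mult fr_t_vcoef[OF assms])
  then show ?thesis
    using vcoef_nonzero[OF assms] by (simp add: psi_neg_def algebra_simps)
qed

lemma wcoef_neq_vcoef:
  assumes "skew_unit h" and "odd s"
  shows "wcoef s h \<noteq> vcoef s h"
proof
  assume "wcoef s h = vcoef s h"
  then have "fr s h = inverse (fr (- s) h)"
    using skew_unit_nonzero[OF assms(1)] by (simp add: wcoef_def vcoef_def fr_inverse)
  then have "fr s (fr s h) = inverse h"
    by (simp add: fr_inverse)
  then have "h * fr (2 * s) h = 1"
    using skew_unit_nonzero[OF assms(1)] by simp
  then show False
    using skew_unit_twist[OF assms] by simp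
qed

lemma ranges_disjoint:
  assumes "skew_unit h" and "odd s" and "psi_pos s h x = psi_neg s h y"
  shows "psi_pos s h x = 0"
proof -
  let ?z = "psi_pos s h x"
  have "wcoef s h * fr (int t) ?z = vcoef s h * fr (int t) ?z"
    using psi_pos_range[OF assms(1)] psi_neg_range[OF assms(1)] assms(3) by metis
  then show ?thesis
    using wcoef_neq_vcoef[OF assms(1,2)] by simp
qed

lemma kernel_psi_pos:
  assumes "skew_unit h" and "odd s"
  shows "\<exists>x. psi_pos s h x = 0 \<and> psi_neg s h x \<noteq> 0"
proof (rule ccontr)
  assume neg: "\<nexists>x. psi_pos s h x = 0 \<and> psi_neg s h x \<noteq> 0"
  define W where "W = fr (- s) (fr (- s) (wcoef s h))"
  have w0: "wcoef s h \<noteq> 0"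
    by (rule wcoef_nonzero[OF assms(1)])
  have barW: "fr (int t) W = inverse W"
    unfolding W_def using fr_t_wcoef[OF assms(1), of s] fr_fr
    by (metis add.commute fr_inverse)
  have "(vcoef s h - inverse W) * fr 0 z + (1 - vcoef s h * W) * fr (0 + int t) z = 0" for z
  proof -
    define y where "y = z - W * fr (int t) z"
    have y: "fr (int t) y = fr (int t) z - inverse W * z"
      unfolding y_def fr_diff fr_mult barW using fr_t_t[of 0 z] by simp
    have W: "fr (2 * s) W = wcoef s h"
      by (simp add: W_def)
    have "psi_pos s h (fr s y) = fr (2 * s) y + wcoef s h * fr (2 * s) (fr (int t) y)"
      by (simp add: psi_pos_def add.commute add.left_commute)
    also have "\<dots> = 0"
      unfolding y unfolding y_def fr_diff fr_mult fr_inverse W using w0 by (simp add: right_diff_distrib)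
    finally have "psi_pos s h (fr s y) = 0" .
    then have "psi_neg s h (fr s y) = 0"
      using neg by blast
    then have "fr (int t) y + vcoef s h * y = 0"
      by (simp add: psi_neg_def)
    then show ?thesis
      unfolding y unfolding y_def by (simp add: algebra_simps)
  qed
  then have "vcoef s h - inverse W = 0 \<and> 1 - vcoef s h * W = 0"
    by (rule gr_indep)
  then have "vcoef s h * W = 1"
    by (metis eq_iff_diff_eq_0)
  then have "fr (2 * s) (vcoef s h * W) = 1"
    by simp
  moreover have "fr (2 * s) (vcoef s h * W) = fr (2 * s) h * inverse (fr s h) * (h * fr s h)"
    by (simp add: W_def vcoef_def wcoef_def fr_mult fr_inverse)
  ultimately have "h * fr (2 * s) h = 1"
    using skew_unit_nonzero[OF assms(1)] by (simp add: field_simps)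
  then show False
    using skew_unit_twist[OF assms] by simp
qed

lemma kernel_psi_neg:
  assumes "skew_unit h" and "odd s"
  shows "\<exists>x. psi_neg s h x = 0 \<and> psi_pos s h x \<noteq> 0"
proof (rule ccontr)
  assume pos: "\<nexists>x. psi_neg s h x = 0 \<and> psi_pos s h x \<noteq> 0"
  define v where "v = vcoef s h"
  define V where "V = fr (2 * s) v"
  have v0: "v \<noteq> 0"
    unfolding v_def by (rule vcoef_nonzero[OF assms(1)])
  have barv: "fr (int t) v = inverse v"
    unfolding v_def by (rule fr_t_vcoef[OF assms(1)])
  have "(1 - wcoef s h * V) * fr (2 * s) z + (wcoef s h - inverse V) * fr (2 * s + int t) z = 0" for z
  proof -
    define y where "y = z - inverse v * fr (int t) z"
    have y: "fr (int t) y = fr (int t) z - v * z"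
      unfolding y_def fr_diff fr_mult fr_inverse barv using fr_t_t[of 0 z] by simp
    have "psi_neg s h (fr s y) = fr (int t) y + v * y"
      by (simp add: psi_neg_def v_def)
    also have "\<dots> = 0"
      unfolding y unfolding y_def using v0 by (simp add: right_diff_distrib)
    finally have "psi_pos s h (fr s y) = 0"
      using pos by blast
    then have "fr (2 * s) y + wcoef s h * fr (2 * s) (fr (int t) y) = 0"
      by (simp add: psi_pos_def add.commute add.left_commute)
    then show ?thesis
      unfolding y unfolding y_def fr_diff fr_mult fr_inverse V_def[symmetric]
      by (simp add: algebra_simps)
  qed
  then have "1 - wcoef s h * V = 0 \<and> wcoef s h - inverse V = 0"
    by (rule gr_indep)
  then have "wcoef s h * V = 1"
    by (metis eq_iff_diff_eq_0)
  moreover have "wcoef s h * V = h * fr s h * (fr (2 * s) h * inverse (fr s h))"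
    by (simp add: V_def v_def vcoef_def wcoef_def fr_mult fr_inverse)
  ultimately have "h * fr (2 * s) h = 1"
    using skew_unit_nonzero[OF assms(1)] by (simp add: field_simps)
  then show False
    using skew_unit_twist[OF assms] by simp
qed

lemma small_multiple_not_dvd:
  assumes "coprime s (int t)" and "0 < k" and "k \<le> 4"
  shows "\<not> int t dvd k * s"
proof
  assume "int t dvd k * s"
  then have "int t dvd k"
    using assms(1) by (simp add: coprime_commute coprime_dvd_mult_left_iff)
  then show False
    using assms(2,3) t_ge_5 zdvd_imp_le[of "int t" k] by simp
qed

lemma not_dvd_multiples:
  assumes "coprime s (int t)"
  shows "\<not> int t dvd s" "\<not> int t dvd 2 * s" "\<not> int t dvd 3 * s" "\<not> int t dvd 4 * s"
  using small_multiple_not_dvd[OF assms, of 1] small_multiple_not_dvd[OF assms, of 2]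
    small_multiple_not_dvd[OF assms, of 3] small_multiple_not_dvd[OF assms, of 4] by simp_all

text \<open>If only the degree of \<open>V\<close> on the right can compete with that of the mixed term,
  then it is excluded by its kernel; otherwise the competitors all factor through \<open>V'\<close> on
  the left and are excluded by their range.\<close>

lemma mixed_term_zero:
  assumes gr: "U \<in> gr s" "V \<in> gr (- s)" "U' \<in> gr s'" "V' \<in> gr (- s')"
    and add: "\<And>x y. V' (x + y) = V' x + V' y" and "U' 0 = 0"
    and disj: "\<And>x y. U' x = V' y \<Longrightarrow> U' x = 0"
    and ker: "\<exists>x. U x = 0 \<and> V x \<noteq> 0"
    and cop: "coprime s (int t)" "coprime s' (int t)"
    and incong: "\<not> int t dvd s' - s" "\<not> int t dvd s' + s"
    and eq: "\<And>x. U' (a * x) + V' (a * x) + U' (b * U x) + U' (b * V x) + V' (b * U x) + V' (b * V x)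
      = c * x + d * U x + d * V x"
  shows "U' (b * U x) = 0"
proof -
  define L where "L = [(\<lambda>x. U' (a * x), s'), (\<lambda>x. V' (a * x), - s'),
    (\<lambda>x. U' (b * U x), s' + s), (\<lambda>x. U' (b * V x), s' + - s),
    (\<lambda>x. V' (b * U x), - s' + s), (\<lambda>x. V' (b * V x), - s' + - s),
    (\<lambda>x. - c * fr 0 x, 0), (\<lambda>x. - d * U x, s), (\<lambda>x. - d * V x, - s)]"
  have "\<forall>(f, e) \<in> set L. f \<in> gr e"
    unfolding L_def list.set ball_simps prod.case
    by (intro conjI TrueI gr_mult_arg[of U'] gr_mult_arg[of V'] gr_comp[of U'] gr_comp[of V']
        gr_scale gr_fr gr)
  moreover have "(\<Sum>(f, e) \<leftarrow> L. f x) = 0" for x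
    unfolding L_def using eq[of x] by (simp add: algebra_simps)
  ultimately have sel: "(\<Sum>(f, e) \<leftarrow> filter (\<lambda>(f, e). int t dvd e - (s' + s)) L. f x) = 0" for x
    by (rule gr_select)
  note nd = not_dvd_multiples[OF cop(1)] not_dvd_multiples[OF cop(2)]
  have nd': "\<not> int t dvd s' - (s' + s)" "\<not> int t dvd s' + - s - (s' + s)"
    "\<not> int t dvd - s' + s - (s' + s)" "\<not> int t dvd 0 - (s' + s)" "\<not> int t dvd s - (s' + s)"
    "int t dvd s' + s - (s' + s)"
  proof -
    have "s' - (s' + s) = - s" "s' + - s - (s' + s) = - (2 * s)" "- s' + s - (s' + s) = - (2 * s')"
      "0 - (s' + s) = - (s' + s)" "s - (s' + s) = - s'" "s' + s - (s' + s) = 0"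
      by simp_all
    then show "\<not> int t dvd s' - (s' + s)" "\<not> int t dvd s' + - s - (s' + s)"
      "\<not> int t dvd - s' + s - (s' + s)" "\<not> int t dvd 0 - (s' + s)" "\<not> int t dvd s - (s' + s)"
      "int t dvd s' + s - (s' + s)"
      using nd incong by (simp_all only: dvd_minus_iff dvd_0_right simp_thms)
  qed
  show ?thesis
  proof (cases "int t dvd - s - (s' + s)")
    case True
    have 1: "\<not> int t dvd - s' - (s' + s)"
    proof
      assume "int t dvd - s' - (s' + s)"
      from dvd_diff[OF this dvd_mult[OF True, of 2]] have "int t dvd 3 * s"
        by simp
      then show False
        using nd by simp
    qed
    have 2: "\<not> int t dvd - s' + - s - (s' + s)"
    proof
      assume "int t dvd - s' + - s - (s' + s)"
      from dvd_diff[OF this dvd_mult[OF True, of 2]] have "int t dvd 2 * s"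
        by simp
      then show False
        using nd by simp
    qed
    have eq1: "U' (b * U x) = d * V x" for x
      using sel[of x] True 1 2 nd' unfolding L_def filter.simps prod.case by simp
    obtain x0 where "U x0 = 0" "V x0 \<noteq> 0"
      using ker by blast
    then have "d = 0"
      using eq1[of x0] \<open>U' 0 = 0\<close> by simp
    then show ?thesis
      using eq1 by simp
  next
    case False
    have V0: "V' 0 = 0"
      by (metis add add.right_neutral add_left_cancel)
    then have minus: "V' (- x) = - V' x" for x
      using add[of x "- x"] by (simp add: add_eq_0_iff)
    have "\<exists>y. U' (b * U x) = V' y"
    proof -
      have "U' (b * U x) + ((if int t dvd - s' - (s' + s) then V' (a * x) else 0) +
          (if int t dvd - s' + - s - (s' + s) then V' (b * V x) else 0)) = 0"
        using sel[of x] False nd' unfolding L_def filter.simps prod.case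
        by (simp split: if_splits add: ac_simps)
      then have "U' (b * U x) = - ((if int t dvd - s' - (s' + s) then V' (a * x) else 0) +
          (if int t dvd - s' + - s - (s' + s) then V' (b * V x) else 0))"
        by (rule eq_neg_iff_add_eq_0[THEN iffD2])
      also have "\<dots> = V' (- ((if int t dvd - s' - (s' + s) then a * x else 0) +
          (if int t dvd - s' + - s - (s' + s) then b * V x else 0)))"
        unfolding minus add by (simp only: V0 if_distrib[of V'])
      finally have "U' (b * U x) = \<dots>" .
      then show ?thesis ..
    qed
    then show ?thesis
      using disj by blast
  qed
qed

lemma psi_pos_eq_0: "psi_pos s h y = 0 \<Longrightarrow> y = - fr (- s) (wcoef s h) * fr (int t) y"
proof -
  assume "psi_pos s h y = 0"
  then have "fr s y = - (wcoef s h * fr (s + int t) y)"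
    by (simp add: psi_pos_def add_eq_0_iff2)
  then have "fr (- s) (fr s y) = fr (- s) (- (wcoef s h * fr (s + int t) y))"
    by (rule arg_cong)
  then show ?thesis
    by (simp add: fr_minus fr_mult)
qed

lemma psi_neg_eq_0: "psi_neg s h y = 0 \<Longrightarrow> fr (int t) y = - fr s (vcoef s h) * y"
proof -
  assume "psi_neg s h y = 0"
  then have "fr (int t - s) y = - (vcoef s h * fr (- s) y)"
    by (simp add: psi_neg_def add_eq_0_iff2)
  then have "fr s (fr (int t - s) y) = fr s (- (vcoef s h * fr (- s) y))"
    by (rule arg_cong)
  then show ?thesis
    by (simp add: fr_minus fr_mult)
qed

lemma coprime_n_imp: "coprime s (int n) \<Longrightarrow> odd s \<and> coprime s (int t)"
  by (auto simp: n_eq)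

lemma psi_composition_exponent:
  assumes h: "skew_unit h" and k: "skew_unit k"
    and s: "coprime s (int n)" and s': "coprime s' (int n)"
    and ab: "a \<noteq> 0 \<or> b \<noteq> 0"
    and eq: "\<And>x. psi t (fr s') k (a * x + b * psi t (fr s) h x) = c * x + d * psi t (fr s) h x"
  shows "int t dvd s' - s \<or> int t dvd s' + s"
proof (rule ccontr)
  assume "\<not> ?thesis"
  then have incong: "\<not> int t dvd s' - s" "\<not> int t dvd s' + s"
    by auto
  have odd: "odd s" "odd s'" and cop: "coprime s (int t)" "coprime s' (int t)"
    using coprime_n_imp s s' by auto
  define U V U' V' where "U = psi_pos s h" and "V = psi_neg s h"
    and "U' = psi_pos s' k" and "V' = psi_neg s' k"
  note defs = U_def V_def U'_def V'_def
  have U'_add: "U' (x + y) = U' x + U' y" and V'_add: "V' (x + y) = V' x + V' y" for x y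
    by (simp_all add: defs psi_pos_add psi_neg_add)
  have gr: "U \<in> gr s" "V \<in> gr (- s)" "U' \<in> gr s'" "V' \<in> gr (- s')"
    by (simp_all add: defs gr_psi_pos gr_psi_neg)
  have disj: "U' x = V' y \<Longrightarrow> U' x = 0" for x y
    unfolding defs by (rule ranges_disjoint[OF k odd(2)])
  have eq': "U' (a * x) + V' (a * x) + U' (b * U x) + U' (b * V x) + V' (b * U x) + V' (b * V x)
      = c * x + d * U x + d * V x" for x
    using eq[of x] unfolding psi_decomp[OF odd(1)] psi_decomp[OF odd(2)] defs[symmetric]
    by (simp add: distrib_left U'_add V'_add ac_simps)
  have kerU: "\<exists>x. U x = 0 \<and> V x \<noteq> 0" and kerV: "\<exists>x. V x = 0 \<and> U x \<noteq> 0"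
    unfolding defs by (rule kernel_psi_pos[OF h odd(1)] kernel_psi_neg[OF h odd(1)])+
  have U'0: "U' 0 = 0"
    by (simp add: defs)
  show False
  proof (cases "b = 0")
    case True
    then have "a \<noteq> 0"
      using ab by simp
    define L where "L = [(\<lambda>x. U' (a * x), s'), (\<lambda>x. V' (a * x), - s'),
      (\<lambda>x. - c * fr 0 x, 0), (\<lambda>x. - d * U x, s), (\<lambda>x. - d * V x, - s)]"
    have "\<forall>(f, e) \<in> set L. f \<in> gr e"
      unfolding L_def list.set ball_simps prod.case
      by (intro conjI TrueI gr_mult_arg[of U'] gr_mult_arg[of V'] gr_scale gr_fr gr)
    moreover have "(\<Sum>(f, e) \<leftarrow> L. f x) = 0" for x
      unfolding L_def using eq'[of x] True U'0 by (simp add: algebra_simps V'_def)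
    ultimately have sel: "(\<Sum>(f, e) \<leftarrow> filter (\<lambda>(f, e). int t dvd e - s') L. f x) = 0" for x
      by (rule gr_select)
    have "- s' - s' = - (2 * s')" "0 - s' = - s'" "s - s' = - (s' - s)" "- s - s' = - (s' + s)"
      "s' - s' = 0"
      by simp_all
    then have "\<not> int t dvd - s' - s'" "\<not> int t dvd 0 - s'" "\<not> int t dvd s - s'"
      "\<not> int t dvd - s - s'" "int t dvd s' - s'"
      using not_dvd_multiples[OF cop(2)] incong by (simp_all only: dvd_minus_iff dvd_0_right simp_thms)
    then have "U' (a * x) = 0" for x
      using sel[of x] unfolding L_def filter.simps prod.case by simp
    then have "U' (a * (x / a)) = 0" for x
      by blast
    then have "U' x = 0" for x
      using \<open>a \<noteq> 0\<close> by simp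
    then show False
      using kernel_psi_neg[OF k odd(2)] by (auto simp: U'_def)
  next
    case False
    have PU: "U' (b * U x) = 0" for x
      by (rule mixed_term_zero[OF gr V'_add U'0 disj kerU cop incong eq'])
    have PV: "U' (b * V x) = 0" for x
    proof (rule mixed_term_zero[of V "- s" U U' s' V'])
      show "\<not> int t dvd s' - - s" "\<not> int t dvd s' + - s"
        using incong by simp_all
      show "U' (a * x) + V' (a * x) + U' (b * V x) + U' (b * U x) + V' (b * V x) + V' (b * U x)
          = c * x + d * V x + d * U x" for x
        using eq'[of x] by (simp only: ac_simps)
    qed (use gr V'_add U'0 disj kerV cop in auto)
    define \<kappa> where "\<kappa> = - fr (- s') (wcoef s' k)"
    obtain x1 where x1: "U x1 \<noteq> 0"
      using kerV by blast
    obtain x2 where x2: "V x2 \<noteq> 0"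
      using kerU by blast
    have "b * U x1 = \<kappa> * fr (int t) (b * U x1)"
      using psi_pos_eq_0[of s' k] PU[of x1] by (simp add: \<kappa>_def U'_def)
    then have "b * (wcoef s h * fr (int t) (U x1)) = \<kappa> * fr (int t) b * fr (int t) (U x1)"
      using psi_pos_range[OF h, of s x1] by (metis U_def fr_mult mult.assoc)
    then have 1: "b * wcoef s h = \<kappa> * fr (int t) b"
      using x1 by (simp flip: mult.assoc)
    have "b * V x2 = \<kappa> * fr (int t) (b * V x2)"
      using psi_pos_eq_0[of s' k] PV[of x2] by (simp add: \<kappa>_def U'_def)
    then have "b * (vcoef s h * fr (int t) (V x2)) = \<kappa> * fr (int t) b * fr (int t) (V x2)"
      using psi_neg_range[OF h, of s x2] by (metis V_def fr_mult mult.assoc)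
    then have "b * vcoef s h = \<kappa> * fr (int t) b"
      using x2 by (simp flip: mult.assoc)
    then show False
      using 1 False wcoef_neq_vcoef[OF h odd(1)] by (metis mult_left_cancel)
  qed
qed

lemma twist_transfer:
  assumes "fr s h * fr (- s) h = fr s k * fr (- s) k"
  shows "h * fr (2 * s) h = k * fr (2 * s) k"
  using arg_cong[OF assms, of "fr s"] by (simp add: fr_mult mult.commute)

lemma psi_composition_twist:
  assumes h: "skew_unit h" and k: "skew_unit k" and s: "coprime s (int n)"
    and ab: "a \<noteq> 0 \<or> b \<noteq> 0"
    and eq: "\<And>x. psi t (fr s) k (a * x + b * psi t (fr s) h x) = c * x + d * psi t (fr s) h x"
  shows "h * fr (2 * s) h = k * fr (2 * s) k"
proof -
  have odd: "odd s" and cop: "coprime s (int t)"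
    using coprime_n_imp s by auto
  define U V U' V' where "U = psi_pos s h" and "V = psi_neg s h"
    and "U' = psi_pos s k" and "V' = psi_neg s k"
  note defs = U_def V_def U'_def V'_def
  have U'_add: "U' (x + y) = U' x + U' y" and V'_add: "V' (x + y) = V' x + V' y" for x y
    by (simp_all add: defs psi_pos_add psi_neg_add)
  have gr: "U \<in> gr s" "V \<in> gr (- s)" "U' \<in> gr s" "V' \<in> gr (- s)"
    by (simp_all add: defs gr_psi_pos gr_psi_neg)
  have eq': "U' (a * x) + V' (a * x) + U' (b * U x) + U' (b * V x) + V' (b * U x) + V' (b * V x)
      = c * x + d * U x + d * V x" for x
    using eq[of x] unfolding psi_decomp[OF odd] defs[symmetric]
    by (simp add: distrib_left U'_add V'_add ac_simps)
  have nonzero: "h \<noteq> 0" "k \<noteq> 0"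
    using h k skew_unit_nonzero by auto
  define L where "L = [(\<lambda>x. U' (a * x), s), (\<lambda>x. V' (a * x), - s),
    (\<lambda>x. U' (b * U x), s + s), (\<lambda>x. U' (b * V x), s + - s),
    (\<lambda>x. V' (b * U x), - s + s), (\<lambda>x. V' (b * V x), - s + - s),
    (\<lambda>x. - c * fr 0 x, 0), (\<lambda>x. - d * U x, s), (\<lambda>x. - d * V x, - s)]"
  have "\<forall>(f, e) \<in> set L. f \<in> gr e"
    unfolding L_def list.set ball_simps prod.case
    by (intro conjI TrueI gr_mult_arg[of U'] gr_mult_arg[of V'] gr_comp[of U'] gr_comp[of V']
        gr_scale gr_fr gr)
  moreover have "(\<Sum>(f, e) \<leftarrow> L. f x) = 0" for x
    unfolding L_def using eq'[of x] by (simp add: algebra_simps)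
  ultimately have sel: "(\<Sum>(f, e) \<leftarrow> filter (\<lambda>(f, e). int t dvd e - m * s) L. f x) = 0" for m x
    by (rule gr_select)
  have dvd_iff: "int t dvd l * s - m * s \<longleftrightarrow> int t dvd l - m" for l m
    using cop by (simp add: coprime_commute coprime_dvd_mult_left_iff flip: left_diff_distrib)
  have deg: "int t dvd s - m * s \<longleftrightarrow> int t dvd 1 - m" "int t dvd - s - m * s \<longleftrightarrow> int t dvd - 1 - m"
    "int t dvd s + s - m * s \<longleftrightarrow> int t dvd 2 - m" "int t dvd s + - s - m * s \<longleftrightarrow> int t dvd 0 - m"
    "int t dvd - s + s - m * s \<longleftrightarrow> int t dvd 0 - m" "int t dvd - s + - s - m * s \<longleftrightarrow> int t dvd - 2 - m"
    "int t dvd 0 - m * s \<longleftrightarrow> int t dvd 0 - m" for m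
    using dvd_iff[of 1 m] dvd_iff[of "- 1" m] dvd_iff[of 2 m] dvd_iff[of 0 m] dvd_iff[of "- 2" m]
    by simp_all
  have nd: "\<not> int t dvd 1" "\<not> int t dvd 2" "\<not> int t dvd 3" "\<not> int t dvd 4"
    using t_ge_5 by (auto dest!: zdvd_imp_le)
  note sel' = sel[unfolded L_def filter.simps prod.case deg]
  have "fr s h * fr (- s) h = fr s k * fr (- s) k"
  proof (cases "b = 0")
    case True
    then have "a \<noteq> 0"
      using ab by simp
    have dU: "U' (a * x) - d * U x = 0" for x
      using sel'[of x 1] nd by simp
    have "(fr s a - d) * fr s x + (wcoef s k * fr (s + int t) a - d * wcoef s h) * fr (s + int t) x = 0" for x
      using dU[of x] unfolding U_def U'_def psi_pos_def by (simp add: fr_mult algebra_simps)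
    from gr_indep[OF this] have 1: "fr s a = d" "wcoef s k * fr (s + int t) a = d * wcoef s h"
      by simp_all
    have dV: "V' (a * x) - d * V x = 0" for x
      using sel'[of x "- 1"] nd by simp
    have "(vcoef s k * fr (- s) a - d * vcoef s h) * fr (- s) x + (fr (- s + int t) a - d) * fr (- s + int t) x = 0" for x
      using dV[of x] unfolding V_def V'_def psi_neg_def by (simp add: fr_mult algebra_simps)
    from gr_indep[OF this] have 2: "fr (- s + int t) a = d" "vcoef s k * fr (- s) a = d * vcoef s h"
      by simp_all
    have d': "fr (s + int t) a = fr (int t) d" "fr (- s) a = fr (int t) d"
      using fr_fr[of "int t" s a] fr_fr[of "int t" "- s + int t" a] fr_t_t[of "- s" a]
      unfolding 1(1) 2(1) by (simp_all only: ac_simps)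
    have "d \<noteq> 0"
      using 1(1) \<open>a \<noteq> 0\<close> by auto
    have "d * (wcoef s h * vcoef s k) = d * (vcoef s h * wcoef s k)"
    proof -
      have "d * (wcoef s h * vcoef s k) = (wcoef s k * fr (int t) d) * vcoef s k"
        by (simp only: mult.assoc[symmetric] 1(2)[unfolded d'])
      also have "\<dots> = (vcoef s k * fr (int t) d) * wcoef s k"
        by (simp only: ac_simps)
      also have "\<dots> = d * (vcoef s h * wcoef s k)"
        by (simp only: 2(2)[unfolded d'] mult.assoc)
      finally show ?thesis .
    qed
    then have "wcoef s h * vcoef s k = vcoef s h * wcoef s k"
      using \<open>d \<noteq> 0\<close> by simp
    then show ?thesis
      unfolding wcoef_def vcoef_def fr_inverse using nonzero by (simp add: field_simps)
  next
    case False
    have PU: "U' (b * U x) = 0" for x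
      using sel'[of x 2] nd by simp
    have PV: "V' (b * V x) = 0" for x
      using sel'[of x "- 2"] nd by simp
    obtain x1 where x1: "U x1 \<noteq> 0"
      using kernel_psi_neg[OF h odd] unfolding defs by blast
    obtain x2 where x2: "V x2 \<noteq> 0"
      using kernel_psi_pos[OF h odd] unfolding defs by blast
    define \<kappa> \<mu> where "\<kappa> = - fr (- s) (wcoef s k)" and "\<mu> = - fr s (vcoef s k)"
    have "b * U x1 = \<kappa> * fr (int t) (b * U x1)"
      using psi_pos_eq_0[of s k] PU[of x1] by (simp add: U'_def \<kappa>_def)
    then have "b * (wcoef s h * fr (int t) (U x1)) = \<kappa> * fr (int t) b * fr (int t) (U x1)"
      using psi_pos_range[OF h, of s x1] by (metis U_def fr_mult mult.assoc)
    then have 1: "b * wcoef s h = \<kappa> * fr (int t) b"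
      using x1 by (simp flip: mult.assoc)
    have "fr (int t) (b * V x2) = \<mu> * (b * V x2)"
      using psi_neg_eq_0[of s k] PV[of x2] by (simp add: V'_def \<mu>_def)
    then have "fr (int t) b * fr (int t) (V x2) = \<mu> * (b * (vcoef s h * fr (int t) (V x2)))"
      using psi_neg_range[OF h, of s x2] by (metis V_def fr_mult)
    then have 2: "fr (int t) b = \<mu> * b * vcoef s h"
      using x2 by (simp flip: mult.assoc)
    have "b * wcoef s h = b * (fr (- s) (wcoef s k) * fr s (vcoef s k) * vcoef s h)"
      using 1 unfolding 2 by (simp add: \<kappa>_def \<mu>_def ac_simps)
    then have "wcoef s h = fr (- s) (wcoef s k) * fr s (vcoef s k) * vcoef s h"
      using False by simp
    then show ?thesis
      unfolding wcoef_def vcoef_def fr_inverse fr_mult fr_fr using nonzero by (simp add: field_simps)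
  qed
  then show ?thesis
    by (rule twist_transfer)
qed

subsection \<open>Equivalences of codes\<close>

lemma sigma_poly_frob: "sigma_poly (frob q) n a x = (\<Sum>i<n. a i * fr (int i) x)"
  by (simp add: sigma_poly_def frob_eq_fr fr_funpow)

lemma Lpoly_add:
  fixes f :: "'a \<Rightarrow> 'a"
  assumes "f \<in> Lpoly n q"
  shows "f (x + y) = f x + f y"
proof -
  obtain a where "f = sigma_poly (frob q) n a"
    using assms by (auto simp: Lpoly_def)
  then show ?thesis
    by (simp add: sigma_poly_frob fr_add distrib_left sum.distrib)
qed

lemma fr_in_Lpoly: "fr j \<in> Lpoly n q"
proof -
  let ?k = "nat (j mod int n)"
  have k: "?k < n"
    using n_pos by (simp add: nat_less_iff)
  have "sigma_poly (frob q) n (\<lambda>i. if i = ?k then 1 else 0) x = fr j x" for x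
  proof -
    have "sigma_poly (frob q) n (\<lambda>i. if i = ?k then 1 else 0) x =
        (\<Sum>i<n. if i = ?k then fr (int i) x else 0)"
      unfolding sigma_poly_frob by (rule sum.cong) auto
    also have "\<dots> = fr (int ?k) x"
      using k by (simp del: int_nat_eq)
    also have "\<dots> = fr j x"
      by (rule fr_eq_of_nat[symmetric])
    finally show ?thesis .
  qed
  then have "fr j = sigma_poly (frob q) n (\<lambda>i. if i = ?k then 1 else 0)"
    by auto
  then show ?thesis
    by (auto simp: Lpoly_def)
qed

lemma Lpoly_plus:
  fixes f g :: "'a \<Rightarrow> 'a"
  assumes "f \<in> Lpoly n q" and "g \<in> Lpoly n q"
  shows "(\<lambda>x. f x + g x) \<in> Lpoly n q"
proof -
  obtain a b where "f = sigma_poly (frob q) n a" "g = sigma_poly (frob q) n b"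
    using assms by (auto simp: Lpoly_def)
  then have "(\<lambda>x. f x + g x) = sigma_poly (frob q) n (\<lambda>i. a i + b i)"
    by (auto simp: sigma_poly_frob distrib_right sum.distrib)
  then show ?thesis
    by (auto simp: Lpoly_def)
qed

lemma Lpoly_scale:
  fixes f :: "'a \<Rightarrow> 'a"
  assumes "f \<in> Lpoly n q"
  shows "(\<lambda>x. c * f x) \<in> Lpoly n q"
proof -
  obtain a where "f = sigma_poly (frob q) n a"
    using assms by (auto simp: Lpoly_def)
  then have "(\<lambda>x. c * f x) = sigma_poly (frob q) n (\<lambda>i. c * a i)"
    by (auto simp: sigma_poly_frob sum_distrib_left mult.assoc)
  then show ?thesis
    by (auto simp: Lpoly_def)
qed

lemma code_subset_Lpoly: "code t (fr s) h \<subseteq> Lpoly n q"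
proof
  fix f
  assume "f \<in> code t (fr s) h"
  then obtain a b where f: "f = (\<lambda>x. a * fr 0 x + b * psi t (fr s) h x)"
    by (auto simp: code_def)
  have "psi t (fr s) h = (\<lambda>x. fr s x + fr (int (t - 1) * s) x + h * fr s h * fr (int (t + 1) * s) x
      + h * fr (- s) (inverse h) * fr (int (2 * t - 1) * s) x)"
    unfolding psi_def fr_funpow inv_fr by simp
  then show "f \<in> Lpoly n q"
    unfolding f by (simp only:) (intro Lpoly_plus Lpoly_scale fr_in_Lpoly)
qed

lemma id_Lpoly_invertible: "Lpoly_invertible n q (id :: 'a \<Rightarrow> 'a)"
proof -
  have "(id :: 'a \<Rightarrow> 'a) = fr 0"
    by auto
  then show ?thesis
    using fr_in_Lpoly[of 0] by (auto simp: Lpoly_invertible_def)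
qed

lemma Lpoly_invertible_bij: "Lpoly_invertible n q f \<Longrightarrow> bij f"
  using o_bij by (auto simp: Lpoly_invertible_def)

lemma code_equiv_refl:
  fixes C :: "('a \<Rightarrow> 'a) set"
  assumes "C \<subseteq> Lpoly n q"
  shows "code_equiv n q C C"
proof -
  have "field_aut (id :: 'a \<Rightarrow> 'a)"
    by (auto simp: field_aut_def)
  moreover have "C = {id \<circ> sigma_poly (frob q) n (id \<circ> a) \<circ> id | a. sigma_poly (frob q) n a \<in> C}"
    using assms by (auto simp: Lpoly_def)
  ultimately show ?thesis
    using id_Lpoly_invertible unfolding code_equiv_def by blast
qed

lemma code_equiv_sandwich:
  fixes C1 C2 :: "('a \<Rightarrow> 'a) set"
  assumes "code_equiv n q C1 C2" and "C2 \<subseteq> Lpoly n q"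
  obtains F G where "bij F" and "bij G" and "\<And>x y. F (x + y) = F x + F y"
    and "C1 = {F \<circ> g \<circ> G | g. g \<in> C2}"
proof -
  obtain f1 f2 \<rho> where f: "Lpoly_invertible n q f1" "Lpoly_invertible n q f2" "field_aut \<rho>"
    and C1: "C1 = {f1 \<circ> sigma_poly (frob q) n (\<rho> \<circ> a) \<circ> f2 | a. sigma_poly (frob q) n a \<in> C2}"
    using assms(1) by (auto simp: code_equiv_def)
  have \<rho>: "bij \<rho>" "\<And>x y. \<rho> (x + y) = \<rho> x + \<rho> y"
    using f(3) by (auto simp: field_aut_def)
  show thesis
  proof
    show "bij (f1 \<circ> \<rho>)" "bij (Hilbert_Choice.inv \<rho> \<circ> f2)"
      using f \<rho>(1) Lpoly_invertible_bij by (auto intro!: bij_comp bij_imp_bij_inv)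
    show "(f1 \<circ> \<rho>) (x + y) = (f1 \<circ> \<rho>) x + (f1 \<circ> \<rho>) y" for x y
      using f(1) by (simp add: Lpoly_invertible_def Lpoly_add \<rho>(2))
    have twist: "sigma_poly (frob q) n (\<rho> \<circ> a) = \<rho> \<circ> sigma_poly (frob q) n a \<circ> Hilbert_Choice.inv \<rho>" for a
      using f(3) by (rule sigma_poly_twist) (rule frob_commute[OF f(3)])
    show "C1 = {f1 \<circ> \<rho> \<circ> g \<circ> (Hilbert_Choice.inv \<rho> \<circ> f2) | g. g \<in> C2}"
      unfolding C1 twist using assms(2) by (force simp: Lpoly_def comp_assoc)
  qed
qed

lemma code_left_idealiser:
  assumes k: "skew_unit k" and s: "coprime s (int n)"
    and f: "f \<in> code t (fr s) k"
    and ideal: "\<And>\<beta>. (\<lambda>x. f (\<beta> * x)) \<in> code t (fr s) k"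
  obtains a where "\<And>x. f x = a * x"
proof -
  have odd: "odd s" and cop: "coprime s (int t)"
    using coprime_n_imp s by auto
  define U V where "U = psi_pos s k" and "V = psi_neg s k"
  have gr: "U \<in> gr s" "V \<in> gr (- s)"
    by (simp_all add: U_def V_def gr_psi_pos gr_psi_neg)
  obtain a b where f_eq: "\<And>x. f x = a * x + b * (U x + V x)"
    using f unfolding code_def psi_decomp[OF odd] U_def V_def by auto
  have "b = 0"
  proof (rule ccontr)
    assume "b \<noteq> 0"
    have conj: "fr (2 * s) \<beta> = fr (int t) \<beta>" for \<beta>
    proof -
      obtain c d where cd: "\<And>x. f (\<beta> * x) = c * x + d * (U x + V x)"
        using ideal[of \<beta>] unfolding code_def psi_decomp[OF odd] U_def V_def by (auto simp: fun_eq_iff)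
      define L where "L = [(\<lambda>x. b * U (\<beta> * x), s), (\<lambda>x. b * V (\<beta> * x), - s),
        (\<lambda>x. (a * \<beta> - c) * fr 0 x, 0), (\<lambda>x. - d * U x, s), (\<lambda>x. - d * V x, - s)]"
      have "\<forall>(f, e) \<in> set L. f \<in> gr e"
        unfolding L_def list.set ball_simps prod.case
        by (intro conjI TrueI gr_scale gr_mult_arg[of U] gr_mult_arg[of V] gr_fr gr)
      moreover have "(\<Sum>(f, e) \<leftarrow> L. f x) = 0" for x
        unfolding L_def using cd[of x] unfolding f_eq by (simp add: algebra_simps)
      ultimately have sel: "(\<Sum>(f, e) \<leftarrow> filter (\<lambda>(f, e). int t dvd e - m) L. f x) = 0" for m x
        by (rule gr_select)
      have nd: "\<not> int t dvd s" "\<not> int t dvd 2 * s" "\<not> int t dvd - (2 * s)"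
        using not_dvd_multiples[OF cop] by simp_all
      have dU: "b * U (\<beta> * x) - d * U x = 0" for x
        using sel[of x s] nd unfolding L_def filter.simps prod.case by simp
      have dV: "b * V (\<beta> * x) - d * V x = 0" for x
        using sel[of x "- s"] nd unfolding L_def filter.simps prod.case by simp
      have "(b * fr s \<beta> - d) * fr s x + (b * wcoef s k * fr (s + int t) \<beta> - d * wcoef s k) * fr (s + int t) x = 0" for x
        using dU[of x] unfolding U_def psi_pos_def by (simp add: fr_mult algebra_simps)
      from gr_indep[OF this] have 1: "b * fr s \<beta> = d"
        by simp
      have "(b * vcoef s k * fr (- s) \<beta> - d * vcoef s k) * fr (- s) x + (b * fr (- s + int t) \<beta> - d) * fr (- s + int t) x = 0" for x
        using dV[of x] unfolding V_def psi_neg_def by (simp add: fr_mult algebra_simps)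
      from gr_indep[OF this] have "b * fr (- s + int t) \<beta> = d"
        by simp
      then have "fr s \<beta> = fr (- s + int t) \<beta>"
        using 1 \<open>b \<noteq> 0\<close> by (metis mult_left_cancel)
      then have "fr s (fr s \<beta>) = fr s (fr (- s + int t) \<beta>)"
        by (rule arg_cong)
      then show ?thesis
        by simp
    qed
    define L where "L = [(fr (2 * s), 2 * s), (\<lambda>x. - 1 * fr (int t) x, int t)]"
    have "\<forall>(f, e) \<in> set L. f \<in> gr e"
      unfolding L_def list.set ball_simps prod.case
      by (intro conjI TrueI gr_scale gr_fr)
    moreover have "(\<Sum>(f, e) \<leftarrow> L. f x) = 0" for x
      unfolding L_def by (simp add: conj)
    ultimately have sel: "(\<Sum>(f, e) \<leftarrow> filter (\<lambda>(f, e). int t dvd e - 2 * s) L. f x) = 0" for x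
      by (rule gr_select)
    have "\<not> int t dvd int t - 2 * s"
      using not_dvd_multiples(2)[OF cop] by (simp add: dvd_diff_right_iff)
    then show False
      using sel[of 1] unfolding L_def filter.simps prod.case by simp
  qed
  then have "f x = a * x" for x
    by (simp add: f_eq)
  then show thesis
    by (rule that)
qed

lemma psi_field_aut:
  fixes \<omega> :: "'a \<Rightarrow> 'a"
  assumes "field_aut \<omega>"
  shows "psi t (fr s) (\<omega> k) (\<omega> x) = \<omega> (psi t (fr s) k x)"
proof -
  have add: "\<And>x y. \<omega> (x + y) = \<omega> x + \<omega> y" and mult: "\<And>x y. \<omega> (x * y) = \<omega> x * \<omega> y"
    and one: "\<omega> 1 = 1"
    using assms by (auto simp: field_aut_def)
  have zero: "\<omega> 0 = 0"
    by (metis add add.right_neutral add_left_cancel)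
  have "\<omega> (inverse y) = inverse (\<omega> y)" for y
    by (cases "y = 0") (simp_all add: zero, metis inverse_unique mult one right_inverse)
  then show ?thesis
    unfolding psi_def fr_funpow inv_fr
    by (simp add: add mult field_aut_fr_commute[OF assms] fr_inverse)
qed

lemma scalar_in_code: "(\<lambda>x. \<beta> * x) \<in> code t (fr s) h"
proof -
  have "(\<lambda>x. \<beta> * x) = (\<lambda>x. \<beta> * x + 0 * psi t (fr s) h x)"
    by simp
  then show ?thesis
    unfolding code_def by blast
qed

lemma psi_in_code: "psi t (fr s) h \<in> code t (fr s) h"
proof -
  have "psi t (fr s) h = (\<lambda>x. 0 * x + 1 * psi t (fr s) h x)"
    by simp
  then show ?thesis
    unfolding code_def by blast
qed

text \<open>Scalars idealise both codes from the left, so conjugation by the left factor \<open>F\<close> of the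
  equivalence permutes them; hence \<open>F\<close> is a multiple of a field automorphism.\<close>

lemma code_equiv_composition:
  assumes equiv: "code_equiv n q (code t (fr s') k) (code t (fr s) h)"
    and k: "skew_unit k" and s': "coprime s' (int n)"
  obtains \<omega> k' a b c d where "field_aut \<omega>" and "\<omega> k' = k" and "skew_unit k'"
    and "a \<noteq> 0 \<or> b \<noteq> 0"
    and "\<And>x. psi t (fr s') k' (a * x + b * psi t (fr s) h x) = c * x + d * psi t (fr s) h x"
proof -
  let ?C1 = "code t (fr s') k" and ?C2 = "code t (fr s) h"
  obtain F G where F: "bij F" and G: "bij G" and F_add: "\<And>x y. F (x + y) = F x + F y"
    and C1: "?C1 = {F \<circ> g \<circ> G | g. g \<in> ?C2}"
    using code_equiv_sandwich[OF equiv code_subset_Lpoly] by blast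
  have F0: "F 0 = 0"
    by (metis F_add add.right_neutral add_left_cancel)
  define m where "m = F 1"
  have m0: "m \<noteq> 0"
    using F F0 by (metis m_def bij_is_inj inj_eq zero_neq_one)
  have semilinear: "F (\<alpha> * y) = F \<alpha> / m * F y" for \<alpha> y
  proof -
    define f where "f = (\<lambda>x. F (\<alpha> * Hilbert_Choice.inv F x))"
    have ideal: "(\<lambda>x. f (c x)) \<in> ?C1" if c: "c \<in> ?C1" for c
    proof -
      obtain g where g: "g \<in> ?C2" "c = F \<circ> g \<circ> G"
        using c unfolding C1 by auto
      then obtain a b where "g = (\<lambda>x. a * x + b * psi t (fr s) h x)"
        by (auto simp: code_def)
      then have "(\<lambda>x. \<alpha> * g x) = (\<lambda>x. (\<alpha> * a) * x + (\<alpha> * b) * psi t (fr s) h x)"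
        by (auto simp: algebra_simps)
      then have "(\<lambda>x. \<alpha> * g x) \<in> ?C2"
        by (auto simp: code_def)
      moreover have "(\<lambda>x. f (c x)) = F \<circ> (\<lambda>x. \<alpha> * g x) \<circ> G"
        using F by (auto simp: f_def g(2) bij_is_inj)
      ultimately show ?thesis
        using C1 by auto
    qed
    note scalar = scalar_in_code[of _ s' k]
    have "f \<in> ?C1"
      using ideal[OF scalar[of 1]] by simp
    then obtain a where a: "\<And>x. f x = a * x"
      using code_left_idealiser[OF k s'] ideal[OF scalar] by blast
    have *: "F (\<alpha> * y) = a * F y" for y
      using a[of "F y"] F by (simp add: f_def bij_is_inj)
    from *[of 1] have "a = F \<alpha> / m"
      using m0 by (simp add: m_def)
    then show ?thesis
      using * by simp
  qed
  define \<omega> where "\<omega> x = F x / m" for x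
  have F_eq: "F x = m * \<omega> x" for x
    using m0 by (simp add: \<omega>_def)
  have mult: "\<omega> (x * y) = \<omega> x * \<omega> y" for x y
    by (simp add: \<omega>_def semilinear)
  have add: "\<omega> (x + y) = \<omega> x + \<omega> y" for x y
    by (simp add: \<omega>_def F_add add_divide_distrib)
  have one: "\<omega> 1 = 1"
    using m0 by (simp add: \<omega>_def m_def)
  have "inj \<omega>"
    using F m0 by (auto intro!: injI simp: \<omega>_def bij_is_inj inj_eq)
  then have bij: "bij \<omega>"
    by (simp add: bij_def finite_UNIV_inj_surj)
  then have aut: "field_aut \<omega>"
    by (auto simp: field_aut_def add mult one)
  obtain k' where k': "\<omega> k' = k"
    using bij by (metis bij_is_surj surjD)
  obtain m' where m': "\<omega> m' = m"
    using bij by (metis bij_is_surj surjD)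
  have zero: "\<omega> 0 = 0"
    by (metis add add.right_neutral add_left_cancel)
  have minus: "\<omega> (- x) = - \<omega> x" for x
    by (metis add zero add.right_inverse minus_unique)
  have "\<omega> (k' * fr (int t) k') = \<omega> (- 1)"
    using k by (simp add: mult field_aut_fr_commute[OF aut] k' minus one skew_unit_def)
  then have skew: "skew_unit k'"
    using bij unfolding skew_unit_def by (metis bij_is_inj inj_eq)
  have "(\<lambda>x. x) \<in> ?C1"
    using scalar_in_code[of 1] by simp
  then obtain g where g: "g \<in> ?C2" "\<And>x. x = F (g (G x))"
    unfolding C1 by (auto simp: fun_eq_iff)
  have "psi t (fr s') k \<in> ?C1"
    by (rule psi_in_code)
  then obtain g' where g': "g' \<in> ?C2" "\<And>x. psi t (fr s') k x = F (g' (G x))"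
    unfolding C1 by (auto simp: fun_eq_iff)
  obtain a b where ab: "\<And>x. g x = a * x + b * psi t (fr s) h x"
    using g(1) by (auto simp: code_def)
  obtain c d where cd: "\<And>x. g' x = c * x + d * psi t (fr s) h x"
    using g'(1) by (auto simp: code_def)
  have comp: "psi t (fr s') k' (m' * g y) = m' * g' y" for y
  proof -
    obtain x where x: "G x = y"
      using G by (metis bij_is_surj surjD)
    have 1: "x = \<omega> (m' * g y)"
      using g(2)[of x] by (simp add: x F_eq mult m')
    have "psi t (fr s') k x = \<omega> (m' * g' y)"
      using g'(2)[of x] by (simp add: x F_eq mult m')
    then have "\<omega> (psi t (fr s') k' (m' * g y)) = \<omega> (m' * g' y)"
      unfolding psi_field_aut[OF aut, symmetric] k' 1[symmetric] .
    then show ?thesis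
      using bij by (metis bij_is_inj inj_eq)
  qed
  show thesis
  proof (rule that[OF aut k' skew])
    show "m' * a \<noteq> 0 \<or> m' * b \<noteq> 0"
    proof (rule ccontr)
      assume "\<not> ?thesis"
      moreover have "m' \<noteq> 0"
        using m' m0 zero by auto
      ultimately have "g x = 0" for x
        by (simp add: ab)
      then show False
        using g(2)[of 1] F0 by simp
    qed
    show "psi t (fr s') k' (m' * a * x + m' * b * psi t (fr s) h x) =
        m' * c * x + m' * d * psi t (fr s) h x" for x
      using comp[of x] by (simp add: ab cd distrib_left mult.assoc)
  qed
qed

lemma code_equiv_exponent:
  assumes "code_equiv n q (code t (fr s') k) (code t (fr s) h)"
    and "skew_unit k" and "skew_unit h" and "coprime s' (int n)" and "coprime s (int n)"
  shows "int t dvd s' - s \<or> int t dvd s' + s"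
  using code_equiv_composition[OF assms(1,2,4)] psi_composition_exponent assms by metis

lemma code_equiv_twist:
  assumes "code_equiv n q (code t (fr s) k) (code t (fr s) h)"
    and "skew_unit k" and h: "skew_unit h" and s: "coprime s (int n)"
  obtains \<omega> u where "field_aut \<omega>" and "\<omega> (h * u) = k"
    and "u * fr (2 * s) u = 1" and "u * fr (int t) u = 1"
proof -
  obtain \<omega> k' a b c d where \<omega>: "field_aut \<omega>" "\<omega> k' = k" and k': "skew_unit k'"
    and ab: "a \<noteq> 0 \<or> b \<noteq> 0"
    and eq: "\<And>x. psi t (fr s) k' (a * x + b * psi t (fr s) h x) = c * x + d * psi t (fr s) h x"
    using code_equiv_composition[OF assms(1,2) s] by metis
  have twist: "h * fr (2 * s) h = k' * fr (2 * s) k'"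
    by (rule psi_composition_twist[OF h k' s ab eq])
  have h0: "h \<noteq> 0" "k' \<noteq> 0"
    using skew_unit_nonzero h k' by auto
  show thesis
  proof
    show "field_aut \<omega>"
      by (rule \<omega>(1))
    show "\<omega> (h * (k' / h)) = k"
      using h0 \<omega>(2) by simp
    show "k' / h * fr (2 * s) (k' / h) = 1"
      using h0 twist by (simp add: fr_divide)
    show "k' / h * fr (int t) (k' / h) = 1"
      using h k' h0 by (simp add: fr_divide skew_unit_def)
  qed
qed

end

section \<open>Counting classes\<close>

lemma finite_field_frobenius_prime_power:
  fixes p r n :: nat
  assumes "card (UNIV :: 'a::{field,finite} set) = (p ^ r) ^ n" and "prime p" and "r > 0" and "n > 0"
  shows "finite_field_frobenius TYPE('a) (p ^ r) n"
proof
  have char: "CHAR('a) = p"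
    using CHAR_eq_prime assms(1,2) by (metis power_mult)
  show "(x + y :: 'a) ^ (p ^ r) = x ^ (p ^ r) + y ^ (p ^ r)" for x y
    by (rule freshmans_dream') (simp_all add: char assms(2))
  show "p ^ r \<ge> 2"
    using prime_ge_2_nat[OF assms(2)] self_le_power[of p r] assms(3) by linarith
qed (use assms in auto)

lemma card_field_aut_le:
  assumes "card (UNIV :: 'a::{field,finite} set) = p ^ m" and "prime p" and "m > 0"
  shows "card {\<omega> :: 'a \<Rightarrow> 'a. field_aut \<omega>} \<le> m"
proof -
  interpret finite_field_frobenius "TYPE('a)" p m
    using finite_field_frobenius_prime_power[of p 1 m] assms by simp
  have "{\<omega> :: 'a \<Rightarrow> 'a. field_aut \<omega>} \<subseteq> (\<lambda>i. fr (int i)) ` {..<m}"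
    using field_aut_in_Gal_prime[OF assms(1,2)] Gal_imp_fr by blast
  then have "card {\<omega> :: 'a \<Rightarrow> 'a. field_aut \<omega>} \<le> card {..<m}"
    by (rule surj_card_le[rotated]) simp
  then show ?thesis
    by simp
qed

lemma card_le_fibres:
  assumes "finite P" and "\<And>x. x \<in> P \<Longrightarrow> card {y \<in> P. f y = f x} \<le> M"
  shows "card P \<le> card (f ` P) * M"
proof -
  have "(\<Union>z \<in> f ` P. {y \<in> P. f y = z}) = P"
    by auto
  moreover have "card (\<Union>z \<in> f ` P. {y \<in> P. f y = z}) \<le> (\<Sum>z \<in> f ` P. card {y \<in> P. f y = z})"
    by (rule card_UN_le) (simp add: assms(1))
  ultimately have "card P \<le> (\<Sum>z \<in> f ` P. card {y \<in> P. f y = z})"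
    by (simp only:)
  also have "\<dots> \<le> (\<Sum>z \<in> f ` P. M)"
    using assms(2) by (intro sum_mono) auto
  finally show ?thesis
    by simp
qed

definition half_totatives :: "nat \<Rightarrow> nat set" where
  "half_totatives t = {a. 0 < a \<and> 2 * a < t \<and> coprime a t}"

lemma finite_half_totatives: "finite (half_totatives t)"
  by (rule finite_subset[of _ "{..t}"]) (auto simp: half_totatives_def)

lemma totient_le_half_totatives:
  assumes "t > 2"
  shows "totient t \<le> 2 * card (half_totatives t)"
proof -
  let ?A = "half_totatives t"
  have "a \<in> ?A \<union> (\<lambda>a. t - a) ` ?A" if "a \<in> totatives t" for a
  proof -
    have a: "0 < a" "a \<le> t" "coprime a t"
      using that by (auto simp: totatives_def)
    consider "2 * a < t" | "2 * a = t" | "2 * a > t"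
      by linarith
    then show ?thesis
    proof cases
      case 1
      then show ?thesis
        using a by (simp add: half_totatives_def)
    next
      case 2
      then have "a dvd t"
        by (metis dvd_triv_right)
      then have "a = 1"
        using a(3) by (metis coprime_common_divisor_nat dvd_refl One_nat_def)
      then show ?thesis
        using 2 assms by simp
    next
      case 3
      have "a \<noteq> t"
        using a(3) assms by auto
      then have "a < t"
        using a(2) by simp
      moreover have "coprime (t - a) t"
        using a(2,3) gcd_diff2_nat[of a t] by (simp add: coprime_iff_gcd_eq_1)
      ultimately have "t - a \<in> ?A"
        using 3 by (simp add: half_totatives_def)
      moreover have "a = t - (t - a)"
        using a(2) by simp
      ultimately show ?thesis
        by blast
    qed
  qed
  then have "totient t \<le> card (?A \<union> (\<lambda>a. t - a) ` ?A)"
    unfolding totient_def by (intro card_mono) (auto simp: finite_half_totatives)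
  also have "\<dots> \<le> card ?A + card ((\<lambda>a. t - a) ` ?A)"
    by (rule card_Un_le)
  also have "\<dots> \<le> 2 * card ?A"
    using card_image_le[OF finite_half_totatives, of "\<lambda>a. t - a" t] by simp
  finally show ?thesis .
qed

definition odd_lift :: "nat \<Rightarrow> nat \<Rightarrow> int" where
  "odd_lift t a = (if odd a then int a else int (a + t))"

lemma coprime_odd_lift:
  assumes "coprime a t"
  shows "coprime (odd_lift t a) (int (2 * t))"
proof -
  have "odd t" if "even a"
    using assms that coprime_common_divisor[of a t 2] by auto
  then have "odd (odd_lift t a)"
    by (auto simp: odd_lift_def)
  moreover have "coprime (odd_lift t a) (int t)"
    using assms by (auto simp: odd_lift_def coprime_iff_gcd_eq_1)
  ultimately show ?thesis
    by simp
qed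

lemma odd_lift_inj:
  assumes "a \<in> half_totatives t" and "b \<in> half_totatives t"
    and "int t dvd odd_lift t a - odd_lift t b \<or> int t dvd odd_lift t a + odd_lift t b"
  shows "a = b"
proof -
  have ab: "0 < a" "2 * a < t" "0 < b" "2 * b < t"
    using assms(1,2) by (auto simp: half_totatives_def)
  have cong: "\<exists>k. odd_lift t c = int c + int t * k" for c
    by (cases "odd c") (auto simp: odd_lift_def intro: exI[of _ 0] exI[of _ 1])
  obtain k l where "odd_lift t a = int a + int t * k" "odd_lift t b = int b + int t * l"
    using cong by meson
  then have "odd_lift t a - odd_lift t b = (int a - int b) + int t * (k - l)"
    "odd_lift t a + odd_lift t b = (int a + int b) + int t * (k + l)"
    by (simp_all add: algebra_simps)
  then have "int t dvd int a - int b \<or> int t dvd int a + int b"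
    using assms(3) by (simp only: dvd_add_left_iff[OF dvd_triv_left])
  moreover have "\<not> int t dvd int a + int b"
    using ab zdvd_imp_le[of "int t" "int a + int b"] by auto
  ultimately have "int t dvd int a - int b"
    by blast
  then have "int a - int b = 0"
    using ab dvd_imp_le_int[of "int a - int b" "int t"] by fastforce
  then show ?thesis
    by simp
qed

context even_degree_frobenius
begin

lemma card_skew_units:
  assumes "odd q"
  shows "q ^ t + 1 \<le> card {h :: 'a. skew_unit h}"
proof -
  define Q where "Q = q ^ t"
  have "odd Q" "Q \<ge> 2"
    using assms q_ge_2 t_ge_5 self_le_power[of q t] by (auto simp: Q_def)
  then obtain M where M: "Q = 2 * M + 1" "M > 0"
    by (auto elim!: oddE)
  have card: "card (UNIV :: 'a set) - 1 = 2 * M * (Q + 1)"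
    by (simp add: card_field n_eq mult_2 power_add M(1) flip: Q_def)
  obtain g :: 'a where g: "g \<noteq> 0" "\<And>x. x \<noteq> 0 \<Longrightarrow> \<exists>k::nat. x = g ^ k"
    using finite_field_primitive_element by blast
  have inj: "inj_on (\<lambda>k. g ^ k) {..<2 * M * (Q + 1)}"
    unfolding card[symmetric] using g by (rule primitive_element_power_inj)
  have order: "g ^ (2 * M * (Q + 1)) = 1"
    using finite_field_power_card_minus_one[OF g(1)] by (simp only: card)
  have "g ^ (M * (Q + 1)) \<noteq> g ^ 0"
    using inj_onD[OF inj, of "M * (Q + 1)" 0] M(2) by auto
  moreover have "(g ^ (M * (Q + 1))) ^ 2 = 1"
    using order by (simp only: power_mult[symmetric] ac_simps)
  ultimately have half: "g ^ (M * (Q + 1)) = - 1"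
    by (simp add: power2_eq_1_iff)
  define e where "e j = M + 2 * M * j" for j
  have "skew_unit (g ^ e j)" for j
  proof -
    have "(g ^ e j) ^ (Q + 1) = g ^ (M * (Q + 1) + 2 * M * (Q + 1) * j)"
      unfolding e_def power_mult[symmetric] by (simp only: algebra_simps)
    also have "\<dots> = - 1"
      by (simp only: power_add[of g "M * (Q + 1)"] power_mult[of g "2 * M * (Q + 1)"] order half power_one mult_1_right)
    finally show ?thesis
      by (simp add: half_norm_def Q_def flip: half_norm_eq)
  qed
  moreover have "inj_on (\<lambda>j. g ^ e j) {..<Q + 1}"
  proof (rule inj_onI)
    fix i j
    assume ij: "i \<in> {..<Q + 1}" "j \<in> {..<Q + 1}" "g ^ e i = g ^ e j"
    have "e i < 2 * M * (Q + 1)" if "i < Q + 1" for i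
    proof -
      have "2 * M * i \<le> 2 * M * Q"
        using that by (intro mult_le_mono) auto
      then show ?thesis
        unfolding e_def distrib_left using M(2) by linarith
    qed
    then have "e i = e j"
      using ij by (intro inj_onD[OF inj]) auto
    then show "i = j"
      using M(2) by (simp add: e_def)
  qed
  ultimately have "card {..<Q + 1} \<le> card {h :: 'a. skew_unit h}"
    by (intro card_inj_on_le) auto
  then show ?thesis
    by (simp add: Q_def)
qed

definition twist_bound :: nat where
  "twist_bound = (if t mod 4 = 2 then q ^ 2 + 1 else 2)"

lemma card_twist_ratios:
  assumes "coprime s (int n)"
  shows "card {u. u * fr (2 * s) u = 1 \<and> u * fr (int t) u = 1} \<le> twist_bound"
proof -
  have "odd s"
    using coprime_n_imp[OF assms] by simp
  then have "{u. u * fr (2 * s) u = 1 \<and> u * fr (int t) u = 1} \<subseteq> {u. u ^ twist_bound = 1}"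
    using twist_ratio_square twist_ratio_power[OF _ _ assms] by (auto simp: twist_bound_def)
  moreover have "twist_bound > 0"
    by (simp add: twist_bound_def)
  ultimately show ?thesis
    using card_roots_power_le[of twist_bound "1 :: 'a"] by (meson card_mono le_trans)
qed

lemma card_code_classes:
  assumes "odd q" and aut: "card {\<omega> :: 'a \<Rightarrow> 'a. field_aut \<omega>} \<le> m"
  shows "totient t * (q ^ t + 1) \<le> 2 * (card (code_classes q t :: ('a \<Rightarrow> 'a) set set set) * (m * twist_bound))"
proof -
  define R :: "(('a \<Rightarrow> 'a) set \<times> ('a \<Rightarrow> 'a) set) set" where
    "R = {(C1, C2). C1 \<in> codes q t \<and> C2 \<in> codes q t \<and> code_equiv (2 * t) q C1 C2}"
  define C where "C = (\<lambda>(a, h). code t (fr (odd_lift t a)) h)"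
  define P where "P = half_totatives t \<times> {h :: 'a. skew_unit h}"
  define \<Phi> where "\<Phi> x = R `` {C x}" for x
  have cop: "coprime (odd_lift t a) (int n)" if "a \<in> half_totatives t" for a
    using that coprime_odd_lift[of a t] by (simp add: half_totatives_def n_eq)
  have C_codes: "C x \<in> codes q t" if "x \<in> P" for x
    using that cop Gal_generator_fr by (auto simp: P_def C_def codes_def half_norm_eq)
  have C_refl: "C x \<in> \<Phi> x" if "x \<in> P" for x
    using C_codes[OF that] code_equiv_refl[OF code_subset_Lpoly]
    by (auto simp: \<Phi>_def R_def C_def n_eq split: prod.splits)
  have "finite P"
    by (simp add: P_def finite_half_totatives)
  moreover have "card {y \<in> P. \<Phi> y = \<Phi> x} \<le> m * twist_bound" if x: "x \<in> P" for x
  proof -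
    obtain a h where ah: "x = (a, h)" "a \<in> half_totatives t" "skew_unit h"
      using x by (auto simp: P_def)
    let ?s = "odd_lift t a"
    let ?A = "{\<omega> :: 'a \<Rightarrow> 'a. field_aut \<omega>}"
    let ?T = "{u. u * fr (2 * ?s) u = 1 \<and> u * fr (int t) u = 1}"
    have "{y \<in> P. \<Phi> y = \<Phi> x} \<subseteq> (\<lambda>(\<omega>, u). (a, \<omega> (h * u))) ` (?A \<times> ?T)"
    proof
      fix y
      assume "y \<in> {y \<in> P. \<Phi> y = \<Phi> x}"
      then have y: "y \<in> P" "\<Phi> y = \<Phi> x"
        by auto
      obtain b k where bk: "y = (b, k)" "b \<in> half_totatives t" "skew_unit k"
        using y(1) by (auto simp: P_def)
      have "C x \<in> \<Phi> y"
        using C_refl[OF x] y(2) by simp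
      then have equiv: "code_equiv n q (code t (fr (odd_lift t b)) k) (code t (fr ?s) h)"
        by (simp add: \<Phi>_def R_def C_def ah bk n_eq)
      have "b = a"
        using code_equiv_exponent[OF equiv bk(3) ah(3) cop[OF bk(2)] cop[OF ah(2)]]
          odd_lift_inj[OF bk(2) ah(2)] by blast
      obtain \<omega> u where "field_aut \<omega>" "\<omega> (h * u) = k" "u * fr (2 * ?s) u = 1" "u * fr (int t) u = 1"
        using code_equiv_twist[OF equiv[unfolded \<open>b = a\<close>] bk(3) ah(3) cop[OF ah(2)]] by blast
      then show "y \<in> (\<lambda>(\<omega>, u). (a, \<omega> (h * u))) ` (?A \<times> ?T)"
        by (intro image_eqI[of _ _ "(\<omega>, u)"]) (auto simp: bk \<open>b = a\<close>)
    qed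
    then have "card {y \<in> P. \<Phi> y = \<Phi> x} \<le> card (?A \<times> ?T)"
      by (rule surj_card_le[rotated]) simp
    also have "\<dots> \<le> m * twist_bound"
      using aut card_twist_ratios[OF cop[OF ah(2)]] by (simp add: card_cartesian_product mult_le_mono)
    finally show ?thesis .
  qed
  ultimately have "card P \<le> card (\<Phi> ` P) * (m * twist_bound)"
    by (rule card_le_fibres)
  moreover have "card (\<Phi> ` P) \<le> card (code_classes q t :: ('a \<Rightarrow> 'a) set set set)"
    using C_codes by (intro card_mono) (auto simp: code_classes_def quotient_def \<Phi>_def R_def)
  ultimately have "card P \<le> card (code_classes q t :: ('a \<Rightarrow> 'a) set set set) * (m * twist_bound)"
    by (meson le_trans mult_le_mono1)
  moreover have "totient t * (q ^ t + 1) \<le> 2 * card P"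
  proof -
    have "totient t * (q ^ t + 1) \<le> (2 * card (half_totatives t)) * card {h :: 'a. skew_unit h}"
      using totient_le_half_totatives[of t] card_skew_units[OF assms(1)] t_ge_5 by (intro mult_le_mono) auto
    then show ?thesis
      by (simp add: P_def card_cartesian_product mult.assoc)
  qed
  ultimately show ?thesis
    by linarith
qed

end

theorem theorem4p12:
  fixes p q r t n :: nat
  assumes "prime p" and "odd p" and "r \<ge> 1" and "q = p ^ r"
    and "t \<ge> 5" and "n = 2 * t"
    and "card (UNIV :: 'a::{field,finite} set) = q ^ n"
  shows "int (card (code_classes q t :: ('a \<Rightarrow> 'a) set set set)) \<ge>
    (if t mod 4 = 2
     then \<lfloor>real (totient t * (q ^ t + 1)) / real (4 * r * t * (q ^ 2 + 1))\<rfloor>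
     else \<lfloor>real (totient t * (q ^ t + 1)) / real (8 * r * t)\<rfloor>)"
proof -
  let ?c = "card (code_classes q t :: ('a \<Rightarrow> 'a) set set set)"
  have q: "odd q"
    using assms(2,4) by simp
  have n: "n > 0"
    using assms(5,6) by simp
  interpret finite_field_frobenius "TYPE('a)" q n
    using finite_field_frobenius_prime_power[of p r n] assms(1,3,4,7) n by simp
  have card_p: "card (UNIV :: 'a set) = p ^ (r * n)"
    using assms(4,7) by (simp add: power_mult)
  have "CHAR('a) = p"
    using CHAR_eq_prime[OF card_p assms(1)] .
  then have "of_nat 2 \<noteq> (0 :: 'a)"
    unfolding of_nat_eq_0_iff_char_dvd using assms(1,2) primes_dvd_imp_eq two_is_prime_nat
    by (metis dvd_refl)
  then interpret even_degree_frobenius "TYPE('a)" q n t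
    using assms(5,6) by unfold_locales simp_all
  have "card {\<omega> :: 'a \<Rightarrow> 'a. field_aut \<omega>} \<le> r * n"
    using card_field_aut_le[OF card_p assms(1)] assms(3) n by simp
  from card_code_classes[OF q this]
  have "totient t * (q ^ t + 1) \<le> ?c * (4 * r * t * twist_bound)"
    by (simp add: assms(6) ac_simps)
  then have bound: "real (totient t * (q ^ t + 1)) \<le> real ?c * real (4 * r * t * twist_bound)"
    unfolding of_nat_mult[symmetric] of_nat_le_iff .
  have "twist_bound > 0"
    by (simp add: twist_bound_def)
  then have "real (totient t * (q ^ t + 1)) / real (4 * r * t * twist_bound) \<le> real ?c"
    using bound assms(3,5) by (subst pos_divide_le_eq) auto
  then have floor: "\<lfloor>real (totient t * (q ^ t + 1)) / real (4 * r * t * twist_bound)\<rfloor> \<le> int ?c"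
    by (simp add: floor_le_iff)
  show ?thesis
  proof (cases "t mod 4 = 2")
    case True
    then have "twist_bound = q ^ 2 + 1"
      by (simp add: twist_bound_def)
    then show ?thesis
      unfolding if_P[OF True] using floor by (simp only:)
  next
    case False
    then have "4 * r * t * twist_bound = 8 * r * t"
      by (simp add: twist_bound_def)
    then show ?thesis
      unfolding if_not_P[OF False] using floor by (simp only:)
  qed
qed

end
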